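(* Suppose $\mathcal Q$ is vertically bounded and $F\in\mathrm{KP}_\infty(\mathcal Q)$. Then for all $Q\in\mathcal Q$ large enough, the polynomial \[G=F_{Q,0}+\sum_{j\in B^{ct}}F_{Q,j}Q^j\] is a minimal limit key polynomial for $\mathcal Q$.
   Context: Let $(K,v)$ be a valued field, $\Gamma$ the divisible hull of $vK$, embedded in a divisible ordered abelian group $\Lambda$. Let $\nu\colon K[x]\to\Lambda\cup\{\infty\}$ be a valuation extending $v$ which is well-specified, i.e. it is not the case that simultaneously $\nu^{-1}(\infty)=0$, the value group of $\nu$ modulo $\Gamma$ is torsion, and the residue field of $\nu$ is algebraic over that of $v$. For $s\ge0$ let $\partial_s$ be the $s$-th Hasse–Schmidt derivative, defined by $f(x+y)=\sum_{s\ge0}(\partial_sf)y^s$. For nonconstant $f$ with $\nu(f)<\infty$ the level is $\epsilon_\nu(f)=\max\{(\nu(f)-\nu(\partial_sf))/s: s\ge1\}$; $\epsilon_\nu(a)=-\infty$ for $a\in K$. A monic $Q\in K[x]$ is a key polynomial for $\nu$ if $\epsilon_\nu(f)<\epsilon_\nu(Q)$ whenever $\deg f<\deg Q$. For monic $Q$, each $f$ has a unique $Q$-expansion $f=\sum_{i\ge0}f_{Q,i}Q^i$ with $\deg f_{Q,i}<\deg Q$; set $\nu_Q(f)=\min_i\nu(f_{Q,i}Q^i)$. Fix $m\ge1$ such that the set $\Psi_m$ of key polynomials of degree $m$ for $\nu$ is nonempty and has no element of maximal $\nu$-value. Let $\mathcal Q\subseteq\Psi_m$ be well-ordered by $Q<R\iff\nu(Q)<\nu(R)$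 and cofinal in $\Psi_m$ for $\nu$-values; write $\gamma_Q=\nu(Q)$. As in the paper, all values $\nu_Q(f)$ ($f\ne0$) lie in $\Gamma$. "For all $Q$ large enough" means for all $Q$ in a final segment of $\mathcal Q$; a family indexed by $\mathcal Q$ is ultimately constant if it is constant on a final segment. $f$ is $\mathcal Q$-stable if $\nu_Q(f)=\nu(f)$ for all $Q$ large enough, $\mathcal Q$-unstable otherwise. Assume unstable polynomials exist; limit key polynomials are the monic $\mathcal Q$-unstable polynomials of minimal degree, forming $\mathrm{KP}_\infty(\mathcal Q)$. For $F\in\mathrm{KP}_\infty(\mathcal Q)$: $D=\lfloor\deg F/m\rfloor$, $F=\sum_{\ell=0}^DF_{Q,\ell}Q^\ell$, $\beta_{Q,\ell}=\nu(F_{Q,\ell})\in\Gamma\cup\{\infty\}$. Let $\delta^L$ be the smallest initial segment of $\Gamma$ containing $\{\nu_Q(F):Q\in\mathcal Q\}$; write $x>\delta^L$ if $x\in(\Gamma\setminus\delta^L)\cup\{\infty\}$. Let $J$ be the set of $\ell\in\{0,\dots,D\}$ with $\beta_{Q,\ell}+\ell\gamma_Q>\delta^L$ for all $Q$ large enough, $B=\{0,\dots,D\}\setminus J$, and $B^{ct}$ the set of $\ell\in B$ for which $(\beta_{Q,\ell})_{Q}$ is ultimately constant. A cut $\eta=(\eta^L,\eta^R)$ of $\Gamma$ is vertically bounded if for every $x\in\eta^L$ and rational $q>1$ there is $y\in\eta^L$ with $q(y-x)>z-x$ for all $z\in\eta^L$. Let $\gamma_{\mathcal Q}$ be the cut of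 $\Gamma$ whose lower set is the smallest initial segment containing $\{\gamma_Q:Q\in\mathcal Q\}$; $\mathcal Q$ is vertically bounded if $\gamma_{\mathcal Q}$ is. A limit key polynomial $G$, with $D_G=\lfloor\deg G/m\rfloor$ and $Q$-expansions $G=\sum G_{Q,\ell}Q^\ell$, is a minimal limit key polynomial for $\mathcal Q$ if there exist $Q\in\mathcal Q$ and $N\subseteq\{0,\dots,D_G\}$ with $G=G_{Q,N}:=\sum_{\ell\in N}G_{Q,\ell}Q^\ell$ such that (1) $G_{R,N}\in\mathrm{KP}_\infty(\mathcal Q)$ for all $R\ge Q$, and (2) for every $\ell\in N$ the set of $R\in\mathcal Q$ with $G_{R,N\setminus\{\ell\}}\notin\mathrm{KP}_\infty(\mathcal Q)$ is cofinal in $\mathcal Q$. *)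

theory Defs
  imports "HOL-Computational_Algebra.Polynomial" "HOL-Library.Extended"
begin

definition nsm :: "nat \<Rightarrow> 'g::linordered_ab_group_add \<Rightarrow> 'g" where
  "nsm n y = (\<Sum>_\<in>{..<n}. y)"

definition zsm :: "int \<Rightarrow> 'g::linordered_ab_group_add \<Rightarrow> 'g" where
  "zsm k y = (if 0 \<le> k then nsm (nat k) y else - nsm (nat (- k)) y)"

definition divisible_group :: "'g::linordered_ab_group_add itself \<Rightarrow> bool" where
  "divisible_group _ \<longleftrightarrow> (\<forall>(x::'g) n. 0 < n \<longrightarrow> (\<exists>y. nsm n y = x))"

text \<open>x / n (well defined in a divisible torsion-free group)\<close>
definition gdiv :: "'g::linordered_ab_group_add \<Rightarrow> nat \<Rightarrow> 'g" where
  "gdiv x n = (THE y. nsm n y = x)"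

definition rscale :: "rat \<Rightarrow> 'g::linordered_ab_group_add \<Rightarrow> 'g" where
  "rscale q w = gdiv (zsm (fst (quotient_of q)) w) (nat (snd (quotient_of q)))"

type_synonym ('k, 'g) pval = "'k poly \<Rightarrow> 'g extended"

text \<open>\<nu> is a valuation on K[x] (possibly with nontrivial support) whose restriction
  to K is a (Krull) valuation v of the field K.\<close>
definition is_valuation :: "('k::field, 'g::linordered_ab_group_add) pval \<Rightarrow> bool" where
  "is_valuation \<nu> \<longleftrightarrow>
     \<nu> 0 = Pinf \<and> \<nu> 1 = Fin 0 \<and> (\<forall>f. \<nu> f \<noteq> Minf) \<and>
     (\<forall>f g. \<nu> (f * g) = \<nu> f + \<nu> g) \<and>
     (\<forall>f g. min (\<nu> f) (\<nu> g) \<le> \<nu> (f + g)) \<and>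
     (\<forall>a. \<nu> [:a:] = Pinf \<longrightarrow> a = 0)"

definition vK :: "('k::field, 'g::linordered_ab_group_add) pval \<Rightarrow> 'g set" where
  "vK \<nu> = {g. \<exists>a. a \<noteq> 0 \<and> \<nu> [:a:] = Fin g}"

definition Gam :: "('k::field, 'g::linordered_ab_group_add) pval \<Rightarrow> 'g set" where
  "Gam \<nu> = {g. \<exists>n>0. nsm n g \<in> vK \<nu>}"

definition supp :: "('k::field, 'g::linordered_ab_group_add) pval \<Rightarrow> 'k poly set" where
  "supp \<nu> = {f. \<nu> f = Pinf}"

text \<open>value group of \<nu> (value group of the induced valuation on the fraction field)\<close>
definition val_group :: "('k::field, 'g::linordered_ab_group_add) pval \<Rightarrow> 'g set" where
  "val_group \<nu> = {g. \<exists>f h a b. \<nu> f = Fin a \<and> \<nu> h = Fin b \<and> g = a - b}"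

text \<open>Residue field of \<nu> (trivial support) algebraic over residue field of v:
  every residue class of f/h with \<nu> f = \<nu> h satisfies a nonzero polynomial over k_v.\<close>
definition residue_algebraic :: "('k::field, 'g::linordered_ab_group_add) pval \<Rightarrow> bool" where
  "residue_algebraic \<nu> \<longleftrightarrow>
     (\<forall>f h c. \<nu> f = Fin c \<and> \<nu> h = Fin c \<longrightarrow>
        (\<exists>n a. (\<forall>i\<le>n. 0 \<le> \<nu> [:a i:]) \<and> (\<exists>i\<le>n. \<nu> [:a i:] = 0) \<and>
               \<nu> (\<Sum>i\<le>n. smult (a i) (f ^ i * h ^ (n - i))) > \<nu> (h ^ n)))"

definition well_specified :: "('k::field, 'g::linordered_ab_group_add) pval \<Rightarrow> bool" where
  "well_specified \<nu> \<longleftrightarrow>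
     \<not> (supp \<nu> = {0} \<and> (\<forall>x\<in>val_group \<nu>. \<exists>n>0. nsm n x \<in> Gam \<nu>) \<and> residue_algebraic \<nu>)"

text \<open>\<partial>_s f = coefficient of y^s in f(x+y)\<close>
definition hasse :: "nat \<Rightarrow> 'k::field poly \<Rightarrow> 'k poly" where
  "hasse s f = coeff (pcompose (map_poly (\<lambda>c. [:c:]) f) [:[:0, 1:], 1:]) s"

definition level_term :: "('k::field, 'g::linordered_ab_group_add) pval \<Rightarrow> 'k poly \<Rightarrow> nat \<Rightarrow> 'g extended" where
  "level_term \<nu> f s = (case (\<nu> f, \<nu> (hasse s f)) of
       (Fin a, Fin b) \<Rightarrow> Fin (gdiv (a - b) s)
     | (Fin a, _) \<Rightarrow> Minf
     | _ \<Rightarrow> Pinf)"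

text \<open>\<epsilon>(a) = -\<infinity> for constants; for nonconstant f with \<nu> f < \<infinity> the max of the terms;
  (convention: \<infinity> if \<nu> f = \<infinity>).\<close>
definition level :: "('k::field, 'g::linordered_ab_group_add) pval \<Rightarrow> 'k poly \<Rightarrow> 'g extended" where
  "level \<nu> f = (if degree f = 0 then Minf
                else if \<nu> f = Pinf then Pinf
                else Max {level_term \<nu> f s | s. 1 \<le> s})"

definition key_poly :: "('k::field, 'g::linordered_ab_group_add) pval \<Rightarrow> 'k poly \<Rightarrow> bool" where
  "key_poly \<nu> Q \<longleftrightarrow> lead_coeff Q = 1 \<and> (\<forall>f. degree f < degree Q \<longrightarrow> level \<nu> f < level \<nu> Q)"

definition Psi :: "('k::field, 'g::linordered_ab_group_add) pval \<Rightarrow> nat \<Rightarrow> 'k poly set" where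
  "Psi \<nu> m = {Q. key_poly \<nu> Q \<and> degree Q = m}"

text \<open>f_{Q,i}: the i-th coefficient of the (unique) Q-expansion of f\<close>
definition qcoeff :: "'k::field poly \<Rightarrow> 'k poly \<Rightarrow> nat \<Rightarrow> 'k poly" where
  "qcoeff Q f i = (f div Q ^ i) mod Q"

definition nuQ :: "('k::field, 'g::linordered_ab_group_add) pval \<Rightarrow> 'k poly \<Rightarrow> 'k poly \<Rightarrow> 'g extended" where
  "nuQ \<nu> Q f = Min (range (\<lambda>i. \<nu> (qcoeff Q f i * Q ^ i)))"

definition ev_Q :: "('k::field, 'g::linordered_ab_group_add) pval \<Rightarrow> 'k poly set \<Rightarrow> ('k poly \<Rightarrow> bool) \<Rightarrow> bool" where
  "ev_Q \<nu> QQ P \<longleftrightarrow> (\<exists>Q0\<in>QQ. \<forall>Q\<in>QQ. \<nu> Q0 \<le> \<nu> Q \<longrightarrow> P Q)"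

definition cofinal_in :: "('k::field, 'g::linordered_ab_group_add) pval \<Rightarrow> 'k poly set \<Rightarrow> 'k poly set \<Rightarrow> bool" where
  "cofinal_in \<nu> S QQ \<longleftrightarrow> (\<forall>R0\<in>QQ. \<exists>R\<in>S. R \<in> QQ \<and> \<nu> R0 \<le> \<nu> R)"

definition ult_const :: "('k::field, 'g::linordered_ab_group_add) pval \<Rightarrow> 'k poly set \<Rightarrow> ('k poly \<Rightarrow> 'b) \<Rightarrow> bool" where
  "ult_const \<nu> QQ h \<longleftrightarrow> (\<exists>c. ev_Q \<nu> QQ (\<lambda>Q. h Q = c))"

definition stable :: "('k::field, 'g::linordered_ab_group_add) pval \<Rightarrow> 'k poly set \<Rightarrow> 'k poly \<Rightarrow> bool" where
  "stable \<nu> QQ f \<longleftrightarrow> ev_Q \<nu> QQ (\<lambda>Q. nuQ \<nu> Q f = \<nu> f)"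

definition KPinf :: "('k::field, 'g::linordered_ab_group_add) pval \<Rightarrow> 'k poly set \<Rightarrow> 'k poly set" where
  "KPinf \<nu> QQ = {F. lead_coeff F = 1 \<and> \<not> stable \<nu> QQ F \<and>
                    (\<forall>G. lead_coeff G = 1 \<and> \<not> stable \<nu> QQ G \<longrightarrow> degree F \<le> degree G)}"

text \<open>lower set of \<delta>: smallest initial segment of \<Gamma> containing {\<nu>_Q(F) : Q \<in> \<Q>}\<close>
definition deltaL :: "('k::field, 'g::linordered_ab_group_add) pval \<Rightarrow> 'k poly set \<Rightarrow> 'k poly \<Rightarrow> 'g set" where
  "deltaL \<nu> QQ F = {x \<in> Gam \<nu>. \<exists>Q\<in>QQ. Fin x \<le> nuQ \<nu> Q F}"

definition above_delta :: "('k::field, 'g::linordered_ab_group_add) pval \<Rightarrow> 'k poly set \<Rightarrow> 'k poly \<Rightarrow> 'g extended \<Rightarrow> bool" where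
  "above_delta \<nu> QQ F x \<longleftrightarrow> x = Pinf \<or> (\<exists>g \<in> Gam \<nu> - deltaL \<nu> QQ F. x = Fin g)"

definition Jset :: "('k::field, 'g::linordered_ab_group_add) pval \<Rightarrow> nat \<Rightarrow> 'k poly set \<Rightarrow> 'k poly \<Rightarrow> nat set" where
  "Jset \<nu> m QQ F = {l. l \<le> degree F div m \<and>
      ev_Q \<nu> QQ (\<lambda>Q. above_delta \<nu> QQ F (\<nu> (qcoeff Q F l) + (\<Sum>_\<in>{..<l}. \<nu> Q)))}"

definition Bset :: "('k::field, 'g::linordered_ab_group_add) pval \<Rightarrow> nat \<Rightarrow> 'k poly set \<Rightarrow> 'k poly \<Rightarrow> nat set" where
  "Bset \<nu> m QQ F = {0..degree F div m} - Jset \<nu> m QQ F"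

definition Bct :: "('k::field, 'g::linordered_ab_group_add) pval \<Rightarrow> nat \<Rightarrow> 'k poly set \<Rightarrow> 'k poly \<Rightarrow> nat set" where
  "Bct \<nu> m QQ F = {l \<in> Bset \<nu> m QQ F. ult_const \<nu> QQ (\<lambda>Q. \<nu> (qcoeff Q F l))}"

definition vert_bounded_cut :: "'g::linordered_ab_group_add set \<Rightarrow> bool" where
  "vert_bounded_cut L \<longleftrightarrow>
     (\<forall>x\<in>L. \<forall>q::rat. 1 < q \<longrightarrow> (\<exists>y\<in>L. \<forall>z\<in>L. z - x < rscale q (y - x)))"

definition gammaL :: "('k::field, 'g::linordered_ab_group_add) pval \<Rightarrow> 'k poly set \<Rightarrow> 'g set" where
  "gammaL \<nu> QQ = {x \<in> Gam \<nu>. \<exists>Q\<in>QQ. Fin x \<le> \<nu> Q}"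

definition vert_bounded :: "('k::field, 'g::linordered_ab_group_add) pval \<Rightarrow> 'k poly set \<Rightarrow> bool" where
  "vert_bounded \<nu> QQ \<longleftrightarrow> vert_bounded_cut (gammaL \<nu> QQ)"

definition qpart :: "'k::field poly \<Rightarrow> 'k poly \<Rightarrow> nat set \<Rightarrow> 'k poly" where
  "qpart Q G N = (\<Sum>l\<in>N. qcoeff Q G l * Q ^ l)"

definition min_limit_KP :: "('k::field, 'g::linordered_ab_group_add) pval \<Rightarrow> nat \<Rightarrow> 'k poly set \<Rightarrow> 'k poly \<Rightarrow> bool" where
  "min_limit_KP \<nu> m QQ G \<longleftrightarrow> G \<in> KPinf \<nu> QQ \<and>
     (\<exists>Q\<in>QQ. \<exists>N \<subseteq> {0..degree G div m}. G = qpart Q G N \<and>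
        (\<forall>R\<in>QQ. \<nu> Q \<le> \<nu> R \<longrightarrow> qpart R G N \<in> KPinf \<nu> QQ) \<and>
        (\<forall>l\<in>N. cofinal_in \<nu> {R. qpart R G (N - {l}) \<notin> KPinf \<nu> QQ} QQ))"

end

theory Submission
  imports Defs
begin

text \<open>
  For a monic \<open>R\<close> of degree \<open>m\<close> and a weight \<open>g\<close>, \<open>w\<^sub>R\<^sub>,\<^sub>g (f) = min\<^sub>i (\<nu> f\<^sub>R\<^sub>,\<^sub>i + i g)\<close>. A Hasse derivative
  argument shows that reduction of \<open>a b\<close> modulo a key polynomial \<open>Q\<close> preserves the value when
  \<open>deg a, deg b < m\<close>; hence \<open>w\<^sub>R\<^sub>,\<^sub>g\<close> is superadditive on products whenever \<open>g = \<nu> Q \<le> \<nu> R\<close>, and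
  \<open>\<nu>\<^sub>Q (F)\<close> is strictly increasing in \<open>Q\<close> exactly for unstable \<open>F\<close>. Consequently subtracting from \<open>F\<close> a
  polynomial whose \<open>\<nu>\<^sub>Q\<close>-value exceeds all \<open>\<nu>\<^sub>S (F)\<close> keeps it unstable, whereas subtracting a term
  below some \<open>\<nu>\<^sub>S (F)\<close> makes it stable. This makes \<open>F\<^sub>Q\<^sub>,\<^sub>B\<close> a minimal limit key polynomial.

  Vertical boundedness gives \<open>B = {0} \<union> B\<^sup>c\<^sup>t\<close>: Taylor-expanding the \<open>P\<close>-expansion of \<open>F\<close> around
  \<open>P - Q\<close>, the coefficient \<open>F\<^sub>Q\<^sub>,\<^sub>l\<close> is the residue modulo \<open>Q\<close> of a polynomial independent of \<open>Q\<close> and of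
  degree less than \<open>deg F\<close> (so its value is ultimately constant), up to carries. The carries are
  controlled already by the weight of a fixed earlier \<open>Q\<^sub>1\<close>; hence their terms have value at least
  \<open>\<nu>\<^sub>P (F) + \<nu> P - \<nu> Q\<^sub>1\<close>, which exceeds all \<open>\<nu>\<^sub>S (F)\<close> once \<open>P\<close> is chosen so that the remaining
  growth of \<open>\<nu> Q\<close> is small compared with \<open>\<nu> P - \<nu> Q\<^sub>1\<close>.
\<close>

section \<open>Multiples in ordered groups and Hasse derivatives\<close>

lemma nsm_0 [simp]: "nsm 0 y = 0"
  and nsm_Suc [simp]: "nsm (Suc n) y = y + nsm n y"
  by (simp_all add: nsm_def add.commute)

lemma nsm_1 [simp]: "nsm 1 y = y"
  by (simp add: nsm_def)

lemma nsm_zero [simp]: "nsm n 0 = 0"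
  by (simp add: nsm_def)

lemma nsm_add: "nsm (a + b) y = nsm a y + nsm b y"
  by (induction a) (simp_all add: add.assoc)

lemma nsm_plus: "nsm n (x + y) = nsm n x + nsm n y"
  by (simp add: nsm_def sum.distrib)

lemma nsm_uminus: "nsm n (- x) = - nsm n x"
  by (simp add: nsm_def sum_negf)

lemma nsm_diff: "nsm n (x - y) = nsm n x - nsm n y"
  by (simp add: nsm_def sum_subtractf)

lemma nsm_nsm: "nsm a (nsm b y) = nsm (a * b) y"
  by (induction a) (simp_all add: nsm_add)

lemma nsm_mono: "x \<le> y \<Longrightarrow> nsm n x \<le> nsm n y"
  by (simp add: nsm_def sum_mono)

lemma nsm_nonneg: "0 \<le> x \<Longrightarrow> 0 \<le> nsm n x"
  using nsm_mono[of 0 x n] by simp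

lemma nsm_ge_self:
  assumes "0 \<le> x" "0 < n"
  shows "x \<le> nsm n x"
  using assms by (cases n) (simp_all add: nsm_nonneg)

lemma nsm_mono_left:
  assumes "0 \<le> x" "a \<le> b"
  shows "nsm a x \<le> nsm b x"
proof -
  have "nsm b x = nsm a x + nsm (b - a) x"
    using assms(2) by (simp flip: nsm_add)
  then show ?thesis using nsm_nonneg[OF assms(1)] by simp
qed

lemma nsm_strict_mono: "x < y \<Longrightarrow> 0 < n \<Longrightarrow> nsm n x < nsm n y"
proof -
  assume "x < y" "0 < n"
  then have "0 < y - x" "y - x \<le> nsm n (y - x)"
    by (simp_all add: nsm_ge_self)
  then have "0 < nsm n (y - x)" by (rule less_le_trans)
  then show ?thesis by (simp add: nsm_diff)
qed

lemma nsm_less_cancel: "0 < n \<Longrightarrow> nsm n x < nsm n y \<longleftrightarrow> x < y"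
  using nsm_mono[of y x n] nsm_strict_mono[of x y n] by (cases "x < y") (auto simp: not_less)

lemma nsm_eq_cancel: "0 < n \<Longrightarrow> nsm n x = nsm n y \<longleftrightarrow> x = y"
  using nsm_strict_mono[of x y n] nsm_strict_mono[of y x n] by (cases x y rule: linorder_cases) auto

lemma nsm_gdiv:
  assumes "divisible_group TYPE('g::linordered_ab_group_add)" "0 < n"
  shows "nsm n (gdiv (x::'g) n) = x"
proof -
  obtain y where "nsm n y = x"
    using assms unfolding divisible_group_def by blast
  then show ?thesis
    unfolding gdiv_def by (rule theI2) (use \<open>nsm n y = x\<close> assms(2) in \<open>auto simp: nsm_eq_cancel\<close>)
qed

text \<open>Clears the denominator of the scalars \<open>(k+1)/k\<close> to which vertical
  boundedness is applied later. \<open>quotient_of\<close> keeps this fraction as it is because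
  consecutive integers are coprime.\<close>

lemma nsm_rscale_succ_ratio:
  assumes "divisible_group TYPE('g::linordered_ab_group_add)" "0 < k"
  shows "nsm k (rscale (Fract (int k + 1) (int k)) (w::'g)) = nsm (Suc k) w"
proof -
  have "quotient_of (Fract (int k + 1) (int k)) = (int k + 1, int k)"
    using assms(2) by (simp add: quotient_of_Fract normalize_stable)
  then show ?thesis
    using assms by (simp add: rscale_def zsm_def nsm_gdiv nat_add_distrib)
qed

lemma Fin_le_add_Fin: "Fin t \<le> x + Fin (s::'g::linordered_ab_group_add) \<longleftrightarrow> Fin (t - s) \<le> x"
  by (cases x) (simp_all add: diff_le_eq)

lemma extended_le_plus_Fin_iff: "x \<le> y + Fin s \<longleftrightarrow> x + Fin (- s) \<le> (y :: 'g::linordered_ab_group_add extended)"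
  by (cases x; cases y) (simp_all add: algebra_simps)

lemma extended_less_plus_Fin_iff: "x < y + Fin s \<longleftrightarrow> x + Fin (- s) < (y :: 'g::linordered_ab_group_add extended)"
  by (cases x; cases y) (simp_all add: algebra_simps)

lemma sum_Fin: "(\<Sum>_\<in>{..<l::nat}. Fin g) = Fin (nsm l g)"
  by (induction l) (simp_all add: zero_extended_def add.commute)

section \<open>Hasse derivatives as coefficients of the shift f(x) -> f(x+y)\<close>

lemma poly_map_const_mult:
  "map_poly (\<lambda>c. [:c:]) (f * g) = map_poly (\<lambda>c. [:c:]) f * map_poly (\<lambda>c. [:c::'a::field:]) g"
proof (rule poly_eqI)
  fix n
  have "[:\<Sum>i\<in>A. h i:] = (\<Sum>i\<in>A. [:h i:])" for A :: "nat set" and h :: "nat \<Rightarrow> 'a"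
    by (rule poly_eqI) (simp add: coeff_sum coeff_pCons split: nat.split)
  then show "coeff (map_poly (\<lambda>c. [:c:]) (f * g)) n
      = coeff (map_poly (\<lambda>c. [:c:]) f * map_poly (\<lambda>c. [:c:]) g) n"
    by (simp add: coeff_map_poly coeff_mult mult.commute)
qed

lemma poly_map_const_add:
  "map_poly (\<lambda>c. [:c:]) (f + g) = map_poly (\<lambda>c. [:c:]) f + map_poly (\<lambda>c. [:c::'a::field:]) g"
  by (rule poly_eqI) (simp add: coeff_map_poly)

text \<open>The shift is a ring homomorphism, so the Leibniz rule is the Cauchy product of
  coefficients in y; no factorials occur and the characteristic does not matter.\<close>

lemma hasse_mult: "hasse s (f * g) = (\<Sum>i\<le>s. hasse i f * hasse (s - i) g)"
  by (simp add: hasse_def poly_map_const_mult pcompose_mult coeff_mult)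

lemma hasse_add: "hasse s (f + g) = hasse s f + hasse s g"
  by (simp add: hasse_def poly_map_const_add pcompose_add)

text \<open>Compares coefficients of y^s in a + (x+y) f(x+y).\<close>

lemma hasse_pCons:
  "hasse s (pCons a f) = (if s = 0 then [:a:] else 0) + [:0, 1:] * hasse s f
     + (if s = 0 then 0 else hasse (s - 1) f)"
  by (cases s) (auto simp: hasse_def map_poly_pCons pcompose_pCons coeff_pCons)

lemma hasse_zero_poly [simp]: "hasse s 0 = 0"
  by (simp add: hasse_def)

lemma hasse_0 [simp]: "hasse 0 f = f"
  by (induction f) (simp_all add: hasse_pCons)

lemma hasse_gt_degree: "degree f < s \<Longrightarrow> hasse s f = 0"
proof (induction f arbitrary: s)
  case (pCons a f)
  then show ?case
    by (cases "f = 0") (auto simp: hasse_pCons)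
qed simp

section \<open>Expansions and valuations\<close>

lemma qcoeff_0 [simp]: "qcoeff Q f 0 = f mod Q"
  by (simp add: qcoeff_def)

lemma qcoeff_Suc: "qcoeff Q f (Suc i) = qcoeff Q (f div Q) i"
  by (simp add: qcoeff_def poly_div_mult_right)

lemma qcoeff_zero [simp]: "qcoeff Q 0 i = 0"
  by (simp add: qcoeff_def)

lemma qcoeff_add: "qcoeff Q (f + g) i = qcoeff Q f i + qcoeff Q g i"
  by (simp add: qcoeff_def poly_div_add_left poly_mod_add_left)

lemma qcoeff_diff: "qcoeff Q (f - g) i = qcoeff Q f i - qcoeff Q g i"
  by (simp add: qcoeff_def poly_div_diff_left poly_mod_diff_left)

lemma qcoeff_sum: "qcoeff Q (\<Sum>x\<in>A. f x) i = (\<Sum>x\<in>A. qcoeff Q (f x) i)"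
  by (induction A rule: infinite_finite_induct) (simp_all add: qcoeff_add)

lemma degree_qcoeff: "0 < degree Q \<Longrightarrow> degree (qcoeff Q f i) < degree Q"
  unfolding qcoeff_def using degree_mod_less[of Q "f div Q ^ i"] by fastforce

lemma qcoeff_small: "degree f < degree Q \<Longrightarrow> qcoeff Q f i = (if i = 0 then f else 0)"
  by (cases i) (auto simp: qcoeff_Suc mod_poly_less div_poly_less)

lemma qcoeff_mult_power:
  assumes "0 < degree Q"
  shows "qcoeff Q (f * Q ^ k) i = (if i < k then 0 else qcoeff Q f (i - k))"
proof (induction k arbitrary: i)
  case (Suc k)
  have "Q \<noteq> 0" using assms by auto
  have "f * Q ^ Suc k = (f * Q ^ k) * Q" by simp
  moreover have "qcoeff Q ((f * Q ^ k) * Q) i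
      = (case i of 0 \<Rightarrow> 0 | Suc i' \<Rightarrow> qcoeff Q (f * Q ^ k) i')"
    using \<open>Q \<noteq> 0\<close> by (cases i) (simp_all add: qcoeff_Suc)
  ultimately have "qcoeff Q (f * Q ^ Suc k) i
      = (case i of 0 \<Rightarrow> 0 | Suc i' \<Rightarrow> qcoeff Q (f * Q ^ k) i')" by (simp only:)
  then show ?case by (auto simp: Suc split: nat.split)
qed simp

text \<open>Uniqueness of the \<open>Q\<close>-expansion: coefficients of degree below that of
  \<open>Q\<close> are already the digits.\<close>

lemma qcoeff_expansion:
  assumes "0 < degree Q" "finite N" "\<And>l. l \<in> N \<Longrightarrow> degree (a l) < degree Q"
  shows "qcoeff Q (\<Sum>l\<in>N. a l * Q ^ l) i = (if i \<in> N then a i else 0)"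
proof -
  have "qcoeff Q (\<Sum>l\<in>N. a l * Q ^ l) i = (\<Sum>l\<in>N. if i = l then a l else 0)"
    unfolding qcoeff_sum qcoeff_mult_power[OF assms(1)]
    by (intro sum.cong) (auto simp: qcoeff_small assms(3) mod_poly_less)
  then show ?thesis using assms(2) by simp
qed

lemma qcoeff_qpart:
  assumes "0 < degree Q" "finite N"
  shows "qcoeff Q (qpart Q f N) i = (if i \<in> N then qcoeff Q f i else 0)"
  unfolding qpart_def using assms by (intro qcoeff_expansion) (simp_all add: degree_qcoeff)

text \<open>Truncated subtraction covers the case \<open>degree f < degree Q\<close>, where the
  quotient is 0.\<close>

lemma degree_div_eq:
  assumes "(Q::'a::field poly) \<noteq> 0"
  shows "degree (f div Q) = degree f - degree Q"
proof (cases "degree f < degree Q")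
  case False
  show ?thesis
  proof (cases "f div Q = 0")
    case True
    then have "f mod Q = f"
      using div_mult_mod_eq[of f Q] by simp
    then have "f = 0 \<or> degree f < degree Q"
      using degree_mod_less[OF assms, of f] by auto
    then show ?thesis using False by auto
  next
    case nz: False
    have fd: "f = f div Q * Q + f mod Q" by simp
    have d: "degree (f div Q * Q) = degree (f div Q) + degree Q"
      using nz assms by (simp add: degree_mult_eq)
    have "degree f = degree (f div Q) + degree Q"
    proof (cases "f mod Q = 0")
      case True
      then show ?thesis using fd d by simp
    next
      case ne: False
      then have "degree (f mod Q) < degree (f div Q * Q)"
        using degree_mod_less[OF assms, of f] d by simp
      then show ?thesis using fd d degree_add_eq_left by metis
    qed
    then show ?thesis by simp
  qed
qed (simp add: div_poly_less)

lemma qcoeff_beyond: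
  assumes "degree f < i * degree Q"
  shows "qcoeff Q f i = 0"
proof -
  have "degree f < degree (Q ^ i)"
    using assms by (cases "Q = 0") (simp_all add: degree_power_eq)
  then show ?thesis by (simp add: qcoeff_def div_poly_less)
qed

lemma expansion_eq:
  assumes "0 < degree Q" "degree f < k * degree Q"
  shows "f = (\<Sum>i<k. qcoeff Q f i * Q ^ i)"
  using assms(2)
proof (induction k arbitrary: f)
  case (Suc k)
  have "Q \<noteq> 0" using assms(1) by auto
  show ?case
  proof (cases "k = 0")
    case True
    then show ?thesis using Suc.prems by (simp add: mod_poly_less)
  next
    case False
    then have "0 < k * degree Q" using assms(1) by simp
    then have "degree (f div Q) < k * degree Q"
      using Suc.prems by (simp add: degree_div_eq[OF \<open>Q \<noteq> 0\<close>] less_diff_conv2 del: nat_0_less_mult_iff)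
    then have "f div Q = (\<Sum>i<k. qcoeff Q (f div Q) i * Q ^ i)" by (rule Suc.IH)
    then have "f div Q * Q = (\<Sum>i<k. qcoeff Q f (Suc i) * Q ^ Suc i)"
      by (simp add: qcoeff_Suc sum_distrib_right mult_ac flip: sum_distrib_left)
    moreover have "f = f mod Q + f div Q * Q" by simp
    ultimately show ?thesis by (simp only: sum.lessThan_Suc_shift) simp
  qed
qed simp

lemma qpart_full:
  assumes "0 < degree Q" "degree f div degree Q \<le> D"
  shows "qpart Q f {0..D} = f"
proof -
  have "degree f < Suc D * degree Q"
    using assms by (metis div_less_iff_less_mult le_imp_less_Suc)
  from expansion_eq[OF assms(1) this] show ?thesis
    by (simp only: qpart_def atLeast0AtMost lessThan_Suc_atMost)
qed

text \<open>The term at \<open>l\<close> has degree below \<open>Suc l * degree Q\<close>. Used to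
  see that discarding the top term, or keeping only terms below it, drops the degree.\<close>

lemma degree_qpart_less:
  assumes "0 < degree Q" "N \<subseteq> {..<D}" "D * degree Q \<le> n" "0 < n"
  shows "degree (qpart Q f N) < n"
  unfolding qpart_def
proof (rule degree_sum_less)
  fix l assume "l \<in> N"
  then have "Suc l \<le> D" using assms(2) by auto
  have "degree (qcoeff Q f l * Q ^ l) \<le> degree (qcoeff Q f l) + l * degree Q"
    by (rule order_trans[OF degree_mult_le add_left_mono])
      (use degree_power_le[of Q l] in \<open>simp add: mult.commute\<close>)
  also have "\<dots> < Suc l * degree Q"
    using degree_qcoeff[OF assms(1), of f l] by simp
  also have "\<dots> \<le> D * degree Q" using \<open>Suc l \<le> D\<close> by (rule mult_le_mono1)
  finally show "degree (qcoeff Q f l * Q ^ l) < n" using assms(3) by simp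
qed (rule assms(4))

section \<open>Ultrametric calculus and the divisible hull of the value group of K\<close>

locale polynomial_valuation =
  fixes \<nu> :: "('k::field, 'g::linordered_ab_group_add) pval"
  assumes val: "is_valuation \<nu>"
begin

lemma nu_0 [simp]: "\<nu> 0 = Pinf"
  and nu_1 [simp]: "\<nu> 1 = Fin 0"
  and nu_not_Minf [simp]: "\<nu> f \<noteq> Minf"
  and nu_mult: "\<nu> (f * g) = \<nu> f + \<nu> g"
  and nu_add_min: "min (\<nu> f) (\<nu> g) \<le> \<nu> (f + g)"
  and nu_const_eq_Pinf: "\<nu> [:a:] = Pinf \<Longrightarrow> a = 0"
  using val unfolding is_valuation_def by blast+

lemma nu_add_ge: "x \<le> \<nu> f \<Longrightarrow> x \<le> \<nu> g \<Longrightarrow> x \<le> \<nu> (f + g)"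
  using nu_add_min[of f g] by (meson min.boundedI order_trans)

lemma nu_add_gt: "x < \<nu> f \<Longrightarrow> x < \<nu> g \<Longrightarrow> x < \<nu> (f + g)"
  using nu_add_min[of f g] by (meson min_less_iff_conj less_le_trans)

text \<open>Twice the value of -1 is 0, and an ordered group has no torsion.\<close>

lemma nu_uminus [simp]: "\<nu> (- f) = \<nu> f"
proof -
  have "\<nu> (-1) + \<nu> (-1) = Fin 0"
    using nu_mult[of "-1" "-1"] by simp
  then obtain c where c: "\<nu> (-1) = Fin c" "c + c = 0"
    by (cases "\<nu> (-1)") auto
  then have "\<nu> (-1) = Fin 0" by simp
  moreover have "- f = -1 * f" by simp
  ultimately show ?thesis
    using nu_mult[of "-1" f] by (metis add_0 zero_extended_def)
qed

lemma nu_diff_ge: "x \<le> \<nu> f \<Longrightarrow> x \<le> \<nu> g \<Longrightarrow> x \<le> \<nu> (f - g)"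
  using nu_add_ge[of x f "- g"] by simp

lemma nu_diff_gt: "x < \<nu> f \<Longrightarrow> x < \<nu> g \<Longrightarrow> x < \<nu> (f - g)"
  using nu_add_gt[of x f "- g"] by simp

lemma nu_sum_ge: "(\<And>i. i \<in> A \<Longrightarrow> x \<le> \<nu> (f i)) \<Longrightarrow> x \<le> \<nu> (\<Sum>i\<in>A. f i)"
  by (induction A rule: infinite_finite_induct) (simp_all add: nu_add_ge)

lemma nu_sum_gt:
  "(\<And>i. i \<in> A \<Longrightarrow> x < \<nu> (f i)) \<Longrightarrow> x < Pinf \<Longrightarrow> x < \<nu> (\<Sum>i\<in>A. f i)"
  by (induction A rule: infinite_finite_induct) (simp_all add: nu_add_gt)

text \<open>Otherwise \<open>f = (f + g) - g\<close> would be a difference of two polynomials of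
  larger value.\<close>

lemma nu_add_eq: "\<nu> f < \<nu> g \<Longrightarrow> \<nu> (f + g) = \<nu> f"
  using nu_add_ge[of "\<nu> f" f g] nu_diff_gt[of "\<nu> f" "f + g" g] by (force simp: not_less)

lemma nu_diff_eq: "\<nu> f < \<nu> g \<Longrightarrow> \<nu> (f - g) = \<nu> f"
  using nu_add_eq[of f "- g"] by simp

lemma nu_power: "\<nu> f = Fin g \<Longrightarrow> \<nu> (f ^ n) = Fin (nsm n g)"
  by (induction n) (simp_all add: nu_mult)

lemma nu_mult_ge: "Fin s \<le> \<nu> f \<Longrightarrow> Fin t \<le> \<nu> g \<Longrightarrow> Fin (s + t) \<le> \<nu> (f * g)"
  by (cases "\<nu> f"; cases "\<nu> g") (simp_all add: nu_mult add_mono)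

lemma nu_mult_gt: "Fin s < \<nu> f \<Longrightarrow> Fin t \<le> \<nu> g \<Longrightarrow> Fin (s + t) < \<nu> (f * g)"
  by (cases "\<nu> f"; cases "\<nu> g") (simp_all add: nu_mult add_less_le_mono)

lemma nu_sum_distinct_values:
  assumes "finite I" "I \<noteq> {}" "inj_on (\<lambda>i. \<nu> (t i)) I"
  shows "\<exists>i\<in>I. \<nu> (\<Sum>i\<in>I. t i) = \<nu> (t i) \<and> (\<forall>j\<in>I. \<nu> (t i) \<le> \<nu> (t j))"
  using assms
proof (induction I rule: finite_ne_induct)
  case (insert x I)
  then obtain i where i: "i \<in> I" "\<nu> (\<Sum>i\<in>I. t i) = \<nu> (t i)" "\<forall>j\<in>I. \<nu> (t i) \<le> \<nu> (t j)"
    by auto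
  have "\<nu> (t x) \<noteq> \<nu> (t i)"
    using insert.prems i(1) insert.hyps(3) by (auto simp: inj_on_def)
  then consider "\<nu> (t x) < \<nu> (t i)" | "\<nu> (t i) < \<nu> (t x)" by fastforce
  then show ?case
  proof cases
    case 1
    then show ?thesis
      using i insert.hyps by (auto simp: nu_add_eq intro: order_trans[OF less_imp_le])
  next
    case 2
    then have "\<nu> ((\<Sum>i\<in>I. t i) + t x) = \<nu> (t i)"
      using i(2) nu_add_eq[of "\<Sum>i\<in>I. t i" "t x"] by simp
    then show ?thesis
      using 2 i insert.hyps by (auto simp: add.commute)
  qed
qed auto

lemma Gam_plus: "x \<in> Gam \<nu> \<Longrightarrow> y \<in> Gam \<nu> \<Longrightarrow> x + y \<in> Gam \<nu>"
proof -
  have vK_plus: "a + b \<in> vK \<nu>" if a: "a \<in> vK \<nu>" and b: "b \<in> vK \<nu>" for a b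
  proof -
    obtain c d where "c \<noteq> 0" "d \<noteq> 0" "\<nu> [:c:] = Fin a" "\<nu> [:d:] = Fin b"
      using a b unfolding vK_def by auto
    then have "c * d \<noteq> 0" "\<nu> [:c * d:] = Fin (a + b)"
      using nu_mult[of "[:c:]" "[:d:]"] by (simp_all add: mult.commute)
    then show ?thesis unfolding vK_def by blast
  qed
  have vK_nsm: "nsm n a \<in> vK \<nu>" if "a \<in> vK \<nu>" "0 < n" for a n
    using that(2,1) by (induction n rule: nat_induct_non_zero) (simp_all add: vK_plus)
  assume "x \<in> Gam \<nu>" "y \<in> Gam \<nu>"
  then obtain k l where kl: "0 < k" "nsm k x \<in> vK \<nu>" "0 < l" "nsm l y \<in> vK \<nu>"
    unfolding Gam_def by auto
  have "nsm (k * l) (x + y) = nsm l (nsm k x) + nsm k (nsm l y)"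
    by (simp add: nsm_plus nsm_nsm mult.commute)
  then have "nsm (k * l) (x + y) \<in> vK \<nu>"
    using kl by (simp add: vK_plus vK_nsm)
  then show ?thesis
    using kl unfolding Gam_def by (metis (mono_tags, lifting) mem_Collect_eq nat_0_less_mult_iff)
qed

lemma Gam_uminus: "x \<in> Gam \<nu> \<Longrightarrow> - x \<in> Gam \<nu>"
proof -
  assume "x \<in> Gam \<nu>"
  then obtain k c where k: "0 < k" "c \<noteq> 0" "\<nu> [:c:] = Fin (nsm k x)"
    unfolding Gam_def vK_def by auto
  have "\<nu> [:c:] + \<nu> [:inverse c:] = Fin 0"
    using nu_mult[of "[:c:]" "[:inverse c:]"] k(2) by (simp flip: one_pCons)
  then have "\<nu> [:inverse c:] = Fin (nsm k (- x))"
    using k(3) by (cases "\<nu> [:inverse c:]") (simp_all add: nsm_uminus eq_neg_iff_add_eq_0 add.commute)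
  then show ?thesis
    using k unfolding Gam_def vK_def by (smt (verit) mem_Collect_eq nonzero_imp_inverse_nonzero)
qed

lemma Gam_diff: "x \<in> Gam \<nu> \<Longrightarrow> y \<in> Gam \<nu> \<Longrightarrow> x - y \<in> Gam \<nu>"
  using Gam_plus[OF _ Gam_uminus] by fastforce

lemma Gam_const: "a \<noteq> 0 \<Longrightarrow> \<nu> [:a:] = Fin g \<Longrightarrow> g \<in> Gam \<nu>"
  unfolding Gam_def vK_def by (metis (mono_tags, lifting) mem_Collect_eq nsm_1 zero_less_one)

lemma Gam_0: "0 \<in> Gam \<nu>"
  using Gam_const[of 1 0] by (simp flip: one_pCons)

lemma Gam_nsm: "x \<in> Gam \<nu> \<Longrightarrow> nsm n x \<in> Gam \<nu>"
  by (induction n) (simp_all add: Gam_0 Gam_plus)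

lemma Gam_nsm_cancel:
  assumes "0 < n" "nsm n x \<in> Gam \<nu>"
  shows "x \<in> Gam \<nu>"
proof -
  obtain k where "0 < k" "nsm k (nsm n x) \<in> vK \<nu>"
    using assms(2) unfolding Gam_def by auto
  then show ?thesis
    using assms(1) unfolding Gam_def nsm_nsm by (metis (mono_tags, lifting) mem_Collect_eq nat_0_less_mult_iff)
qed

end

section \<open>Multiplication modulo a key polynomial\<close>

locale key_polynomial_family = polynomial_valuation \<nu>
  for \<nu> :: "('k::field, 'g::linordered_ab_group_add) pval" +
  fixes m :: nat and QQ :: "'k poly set"
  assumes div: "divisible_group TYPE('g)"
    and m_pos: "1 \<le> m"
    and Psi_ne: "Psi \<nu> m \<noteq> {}"
    and Psi_nomax: "\<forall>P\<in>Psi \<nu> m. \<exists>P'\<in>Psi \<nu> m. \<nu> P < \<nu> P'"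
    and QQ_sub: "QQ \<subseteq> Psi \<nu> m"
    and QQ_cof: "\<forall>P\<in>Psi \<nu> m. \<exists>Q\<in>QQ. \<nu> P \<le> \<nu> Q"
begin

lemma Psi_lead_coeff: "Q \<in> Psi \<nu> m \<Longrightarrow> lead_coeff Q = 1"
  and Psi_degree: "Q \<in> Psi \<nu> m \<Longrightarrow> degree Q = m"
  and Psi_level: "Q \<in> Psi \<nu> m \<Longrightarrow> degree f < m \<Longrightarrow> level \<nu> f < level \<nu> Q"
  by (auto simp: Psi_def key_poly_def)

lemma Psi_degree_diff:
  assumes "Q \<in> Psi \<nu> m" "R \<in> Psi \<nu> m"
  shows "degree (Q - R) < m"
proof (rule ccontr)
  assume "\<not> ?thesis"
  moreover have "degree (Q - R) \<le> m"
    using assms Psi_degree by (intro degree_diff_le) auto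
  ultimately have "degree (Q - R) = m" by simp
  moreover have "coeff (Q - R) m = 0"
    using Psi_degree[OF assms(1)] Psi_degree[OF assms(2)] Psi_lead_coeff[OF assms(1)]
      Psi_lead_coeff[OF assms(2)] by simp
  ultimately have "Q - R = 0" using leading_coeff_0_iff[of "Q - R"] by simp
  then show False using \<open>degree (Q - R) = m\<close> m_pos by simp
qed

lemma Psi_finite_value: "Q \<in> Psi \<nu> m \<Longrightarrow> \<exists>g. \<nu> Q = Fin g"
  using Psi_nomax by (cases "\<nu> Q") fastforce+

text \<open>Multiplying by \<open>s\<close> removes the division, so levels turn into linear bounds
  on the values of Hasse derivatives.\<close>

lemma level_term_le_iff:
  assumes "\<nu> f = Fin a" "1 \<le> s"
  shows "level_term \<nu> f s \<le> Fin e \<longleftrightarrow> Fin (a - nsm s e) \<le> \<nu> (hasse s f)"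
    and "level_term \<nu> f s < Fin e \<longleftrightarrow> Fin (a - nsm s e) < \<nu> (hasse s f)"
proof -
  have s: "0 < s" using assms(2) by simp
  have "gdiv x s < e \<longleftrightarrow> x < nsm s e" "gdiv x s \<le> e \<longleftrightarrow> x \<le> nsm s e" for x
    using nsm_less_cancel[OF s, of "gdiv x s" e] nsm_less_cancel[OF s, of e "gdiv x s"]
      nsm_gdiv[OF div s, of x] by (auto simp: not_less[symmetric])
  then show "level_term \<nu> f s \<le> Fin e \<longleftrightarrow> Fin (a - nsm s e) \<le> \<nu> (hasse s f)"
    "level_term \<nu> f s < Fin e \<longleftrightarrow> Fin (a - nsm s e) < \<nu> (hasse s f)"
    using assms(1) by (cases "\<nu> (hasse s f)"; simp add: level_term_def algebra_simps)+
qed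

lemma finite_level_terms: "\<nu> f \<noteq> Pinf \<Longrightarrow> finite {level_term \<nu> f s | s. 1 \<le> s}"
proof (rule finite_subset)
  assume "\<nu> f \<noteq> Pinf"
  then obtain a where "\<nu> f = Fin a" by (cases "\<nu> f") auto
  then have "level_term \<nu> f s \<in> insert Minf (level_term \<nu> f ` {..degree f})" for s
    by (cases "degree f < s") (simp_all add: level_term_def hasse_gt_degree)
  then show "{level_term \<nu> f s | s. 1 \<le> s} \<subseteq> insert Minf (level_term \<nu> f ` {..degree f})"
    by blast
qed simp

text \<open>The level of \<open>Q\<close> is a finite maximum; at the order \<open>b\<close>
  attaining it the derivative bound is an equality.\<close>

lemma key_poly_level:
  assumes Q: "Q \<in> Psi \<nu> m" and g: "\<nu> Q = Fin g"
  obtains e b h where "1 \<le> b" "\<nu> (hasse b Q) = Fin h" "h = g - nsm b e"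
    "\<And>s. 1 \<le> s \<Longrightarrow> Fin (g - nsm s e) \<le> \<nu> (hasse s Q)"
    "level \<nu> Q = Fin e"
proof -
  let ?S = "{level_term \<nu> Q s | s. 1 \<le> s}"
  have fin: "finite ?S" using finite_level_terms g by simp
  have lev: "level \<nu> Q = Max ?S"
    using g Psi_degree[OF Q] m_pos by (simp add: level_def)
  have "?S \<noteq> {}" by auto
  then have "Max ?S \<in> ?S" using fin by (rule Max_in[rotated])
  then obtain b where b: "1 \<le> b" "Max ?S = level_term \<nu> Q b" by auto
  \<comment> \<open>The polynomial 0 counts as constant, so it has level \<open>Minf\<close>, which
    a key polynomial must exceed.\<close>
  have "level \<nu> Q > Minf"
    using Psi_level[OF Q, of 0] m_pos by (simp add: level_def)
  then obtain h where h: "\<nu> (hasse b Q) = Fin h"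
    using b lev g by (cases "\<nu> (hasse b Q)") (simp_all add: level_term_def)
  define e where "e = gdiv (g - h) b"
  have e: "level \<nu> Q = Fin e"
    using b lev g h by (simp add: level_term_def e_def)
  have "h = g - nsm b e"
    using nsm_gdiv[OF div, of b "g - h"] b(1) by (simp add: e_def)
  moreover have "Fin (g - nsm s e) \<le> \<nu> (hasse s Q)" if "1 \<le> s" for s
  proof -
    have "level_term \<nu> Q s \<le> Max ?S"
      by (rule Max_ge[OF fin]) (use that in auto)
    then show ?thesis
      using level_term_le_iff(1)[OF g that] e lev by simp
  qed
  ultimately show ?thesis using that b(1) h e by blast
qed

text \<open>The inequality of levels rewritten for derivatives; its strictness, against the equality
  attained by \<open>Q\<close>, drives \<open>key_mult\<close>. An infinite value is excluded
  because a nonconstant \<open>f\<close> would then have level \<open>Pinf\<close>.\<close>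

lemma small_level:
  assumes Q: "Q \<in> Psi \<nu> m" and e: "level \<nu> Q = Fin e" and f: "degree f < m" "f \<noteq> 0"
  obtains a where "\<nu> f = Fin a" "\<And>s. 1 \<le> s \<Longrightarrow> Fin (a - nsm s e) < \<nu> (hasse s f)"
proof (cases "degree f = 0")
  case True
  then obtain c where c: "f = [:c:]" "c \<noteq> 0" using f(2) by (metis degree_eq_zeroE pCons_0_0)
  then obtain a where "\<nu> f = Fin a"
    using nu_const_eq_Pinf[of c] by (cases "\<nu> f") auto
  moreover have "Fin (a - nsm s e) < \<nu> (hasse s f)" if "1 \<le> s" for s
    using that True by (simp add: hasse_gt_degree)
  ultimately show ?thesis using that by blast
next
  case False
  have less: "level \<nu> f < Fin e" using Psi_level[OF Q f(1)] e by simp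
  then have nP: "\<nu> f \<noteq> Pinf" using False by (auto simp: level_def)
  then obtain a where a: "\<nu> f = Fin a" by (cases "\<nu> f") auto
  have "Fin (a - nsm s e) < \<nu> (hasse s f)" if "1 \<le> s" for s
  proof -
    have "level_term \<nu> f s \<le> level \<nu> f"
      using False nP that finite_level_terms[OF nP] by (auto simp: level_def intro!: Max_ge)
    then have "level_term \<nu> f s < Fin e" using less by (rule le_less_trans)
    then show ?thesis using level_term_le_iff(2)[OF a that] by simp
  qed
  then show ?thesis using that a by blast
qed

lemma small_finite_value:
  assumes "degree f < m" "f \<noteq> 0"
  shows "\<exists>a. \<nu> f = Fin a"
proof -
  obtain Q where Q: "Q \<in> Psi \<nu> m" using Psi_ne by auto
  then obtain g where g: "\<nu> Q = Fin g" using Psi_finite_value by blast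
  from key_poly_level[OF Q g] obtain e where "level \<nu> Q = Fin e" by metis
  from small_level[OF Q this assms] show ?thesis by metis
qed

lemma small_value_eq_Pinf: "degree f < m \<Longrightarrow> \<nu> f = Pinf \<longleftrightarrow> f = 0"
  using small_finite_value[of f] by (cases "f = 0") auto

text \<open>If the conclusion failed, then \<open>\<nu> (c * Q) \<le> \<nu> (a * b)\<close> for the quotient \<open>c\<close>. A Hasse
  derivative of order \<open>s\<close> at which the level \<open>e\<close> of \<open>Q\<close> is attained lowers the value of \<open>c * Q\<close> by
  exactly \<open>s e\<close>, but those of \<open>a * b\<close> and of the remainder by strictly less.\<close>

lemma key_mult:
  assumes Q: "Q \<in> Psi \<nu> m" and a: "degree a < m" "a \<noteq> 0" and b: "degree b < m" "b \<noteq> 0"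
  shows "\<nu> ((a * b) mod Q) = \<nu> (a * b)" "\<nu> (a * b) < \<nu> ((a * b) div Q * Q)"
proof -
  define c d where "c = (a * b) div Q" and "d = (a * b) mod Q"
  have ab: "a * b = c * Q + d" by (simp add: c_def d_def)
  obtain g where g: "\<nu> Q = Fin g" using Psi_finite_value[OF Q] by blast
  obtain e s h where s: "1 \<le> s" and h: "\<nu> (hasse s Q) = Fin h" "h = g - nsm s e"
    and Qs: "\<And>s. 1 \<le> s \<Longrightarrow> Fin (g - nsm s e) \<le> \<nu> (hasse s Q)" and e: "level \<nu> Q = Fin e"
    using key_poly_level[OF Q g] by metis
  obtain \<alpha> where \<alpha>: "\<nu> a = Fin \<alpha>" "\<And>s. 1 \<le> s \<Longrightarrow> Fin (\<alpha> - nsm s e) < \<nu> (hasse s a)"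
    using small_level[OF Q e a] by metis
  obtain \<beta> where \<beta>: "\<nu> b = Fin \<beta>" "\<And>s. 1 \<le> s \<Longrightarrow> Fin (\<beta> - nsm s e) < \<nu> (hasse s b)"
    using small_level[OF Q e b] by metis
  have nab: "\<nu> (a * b) = Fin (\<alpha> + \<beta>)" using \<alpha> \<beta> by (simp add: nu_mult)
  have "Q \<noteq> 0" using Psi_degree[OF Q] m_pos by auto
  have main: "\<nu> (a * b) < \<nu> (c * Q)"
  proof (rule ccontr)
    assume "\<not> ?thesis"
    then have le1: "\<nu> (c * Q) \<le> \<nu> (a * b)" by simp
    then have c0: "c \<noteq> 0" using nab by auto
    have "degree c < m"
      using a b Psi_degree[OF Q] by (simp add: c_def degree_div_eq[OF \<open>Q \<noteq> 0\<close>] degree_mult_eq)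
    from small_level[OF Q e this c0] obtain \<kappa>
      where \<kappa>: "\<nu> c = Fin \<kappa>" "\<And>s. 1 \<le> s \<Longrightarrow> Fin (\<kappa> - nsm s e) < \<nu> (hasse s c)" by metis
    \<comment> \<open>\<open>t\<close> is the value of \<open>c * hasse s Q\<close>, the Leibniz
      term of \<open>c * Q\<close> with all derivatives on \<open>Q\<close>. Every other quantity of
      order \<open>s\<close> below is shown to exceed it.\<close>
    define t where "t = \<kappa> + g - nsm s e"
    have le: "\<kappa> + g \<le> \<alpha> + \<beta>" using le1 nab \<kappa> g by (simp add: nu_mult)
    have hab: "Fin t < \<nu> (hasse s (a * b))"
      unfolding hasse_mult
    proof (rule nu_sum_gt)
      fix i assume "i \<in> {..s}"
      then have eq: "nsm s e = nsm i e + nsm (s - i) e" by (simp flip: nsm_add)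
      have "Fin ((\<alpha> - nsm i e) + (\<beta> - nsm (s - i) e)) < \<nu> (hasse i a * hasse (s - i) b)"
      proof (cases "i = 0")
        case True
        then show ?thesis
          using nu_mult_gt[OF \<beta>(2)[OF s], of "\<alpha>" a] \<alpha>(1)
          by (simp add: algebra_simps)
      next
        case False
        have "Fin (\<beta> - nsm (s - i) e) \<le> \<nu> (hasse (s - i) b)"
          using \<beta>(2)[of "s - i"] \<beta>(1) by (cases "s - i = 0") simp_all
        then show ?thesis using nu_mult_gt[OF \<alpha>(2)] False by simp
      qed
      moreover have "t \<le> (\<alpha> - nsm i e) + (\<beta> - nsm (s - i) e)"
        using le eq by (simp add: t_def algebra_simps)
      ultimately show "Fin t < \<nu> (hasse i a * hasse (s - i) b)"
        by (meson le_less_trans less_eq_extended.simps(1))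
    qed simp
    have hd: "Fin t < \<nu> (hasse s d)"
    proof (cases "d = 0")
      case False
      have "degree d < m"
        unfolding d_def using Psi_degree[OF Q] degree_mod_less[OF \<open>Q \<noteq> 0\<close>, of "a * b"] m_pos by auto
      from small_level[OF Q e this False] obtain \<rho>
        where \<rho>: "\<nu> d = Fin \<rho>" "Fin (\<rho> - nsm s e) < \<nu> (hasse s d)" using s by metis
      \<comment> \<open>Under the assumption to be refuted, both terms of this difference have value
        at least \<open>\<nu> (c * Q)\<close>.\<close>
      have "d = a * b - c * Q" using ab by simp
      then have "\<nu> (c * Q) \<le> \<nu> d" using nu_diff_ge[OF le1, of "c * Q"] by simp
      then have "t \<le> \<rho> - nsm s e" using \<kappa> g \<rho> by (simp add: nu_mult t_def)
      then show ?thesis using \<rho>(2) by (meson le_less_trans less_eq_extended.simps(1))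
    qed simp
    have "hasse s (a * b) = hasse s (c * Q) + hasse s d"
      by (subst ab) (rule hasse_add)
    then have gt: "Fin t < \<nu> (hasse s (c * Q))"
      using nu_diff_gt[OF hab hd] by simp
    have rest: "Fin t < \<nu> (\<Sum>i\<in>{1..s}. hasse i c * hasse (s - i) Q)"
    proof (rule nu_sum_gt)
      fix i assume i: "i \<in> {1..s}"
      then have eq: "nsm s e = nsm i e + nsm (s - i) e" by (simp flip: nsm_add)
      have "Fin (g - nsm (s - i) e) \<le> \<nu> (hasse (s - i) Q)"
        using Qs[of "s - i"] g by (cases "s - i = 0") simp_all
      from nu_mult_gt[OF \<kappa>(2) this] i show "Fin t < \<nu> (hasse i c * hasse (s - i) Q)"
        by (simp add: t_def eq algebra_simps)
    qed simp
    have lead: "\<nu> (c * hasse s Q) = Fin t"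
      using \<kappa>(1) h by (simp add: nu_mult t_def add_diff_eq)
    have "{..s} = insert 0 {1..s}" by auto
    then have "hasse s (c * Q) = c * hasse s Q + (\<Sum>i\<in>{1..s}. hasse i c * hasse (s - i) Q)"
      by (simp add: hasse_mult)
    then have "\<nu> (hasse s (c * Q)) = Fin t"
      using nu_add_eq[of "c * hasse s Q"] lead rest by simp
    then show False using gt by simp
  qed
  then show "\<nu> (a * b) < \<nu> ((a * b) div Q * Q)" by (simp add: c_def)
  have "\<nu> (a * b - c * Q) = \<nu> (a * b)" using main by (rule nu_diff_eq)
  moreover have "a * b - c * Q = d" using ab by simp
  ultimately show "\<nu> ((a * b) mod Q) = \<nu> (a * b)" by (simp add: d_def)
qed

text \<open>Minimal counterexample \<open>f\<close>: in the \<open>f\<close>-expansion \<open>Q = q\<^sub>0 + q\<^sub>1 f + \<dots>\<close> the terms have pairwise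
  distinct values, whereas \<open>key_mult\<close> forces \<open>\<nu> (Q - q\<^sub>0) = \<nu> q\<^sub>0\<close>.\<close>

lemma small_value_in_Gam:
  "degree f < m \<Longrightarrow> f \<noteq> 0 \<Longrightarrow> \<nu> f = Fin a \<Longrightarrow> a \<in> Gam \<nu>"
proof (induction "degree f" arbitrary: f a rule: less_induct)
  case less
  show ?case
  proof (cases "degree f = 0")
    case True
    then obtain c where "f = [:c:]" "c \<noteq> 0" using less.prems by (metis degree_eq_zeroE pCons_0_0)
    then show ?thesis using Gam_const less.prems by simp
  next
    case False
    then have d: "0 < degree f" by simp
    obtain Q where Q: "Q \<in> Psi \<nu> m" using Psi_ne by auto
    have "Q \<noteq> 0" using Psi_degree[OF Q] m_pos by auto
    \<comment> \<open>The roles are exchanged: \<open>Q\<close> is expanded in \<open>f\<close>, so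
      that the digits fall under the induction hypothesis.\<close>
    define q where "q i = qcoeff f Q i" for i
    have dq: "degree (q i) < degree f" for i unfolding q_def by (rule degree_qcoeff[OF d])
    have qGam: "b \<in> Gam \<nu>" if "q i \<noteq> 0" "\<nu> (q i) = Fin b" for i b
      using less.hyps[OF dq _ that] dq[of i] less.prems(1) by simp
    define S where "S = Q div f"
    have QS: "Q = f * S + q 0" by (simp add: S_def q_def mult.commute)
    have "degree S < m" using d Psi_degree[OF Q] m_pos by (simp add: S_def degree_div_eq less.prems)
    have "S \<noteq> 0"
    proof
      assume "S = 0"
      then have "Q = q 0" using QS by simp
      then show False using dq[of 0] Psi_degree[OF Q] less.prems(1) by simp
    qed
    have "f * S = 1 * Q + (- q 0)" using QS by simp
    moreover have "degree (- q 0) < degree Q"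
      using dq[of 0] Psi_degree[OF Q] less.prems(1) by simp
    ultimately have "(f * S) mod Q = - q 0"
      by (metis mod_mult_self3 mod_poly_less)
    then have fS: "\<nu> (f * S) = \<nu> (q 0)"
      using key_mult(1)[OF Q less.prems(1,2) \<open>degree S < m\<close> \<open>S \<noteq> 0\<close>] by simp
    obtain \<sigma> where \<sigma>: "\<nu> S = Fin \<sigma>" using small_finite_value \<open>degree S < m\<close> \<open>S \<noteq> 0\<close> by blast
    then have q0: "\<nu> (q 0) = Fin (a + \<sigma>)" using fS less.prems by (simp add: nu_mult)
    then have "q 0 \<noteq> 0" by auto
    define k where "k = Suc m"
    have "degree Q < k * degree f" using d Psi_degree[OF Q] by (cases "degree f") (simp_all add: k_def)
    from expansion_eq[OF d this] have "Q = (\<Sum>i<k. q i * f ^ i)" by (simp add: q_def)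
    also have "\<dots> = q 0 + (\<Sum>i\<in>{1..<k}. q i * f ^ i)"
      by (simp add: k_def lessThan_atLeast0 sum.atLeast_Suc_lessThan)
    also have "(\<Sum>i\<in>{1..<k}. q i * f ^ i) = (\<Sum>i\<in>{i\<in>{1..<k}. q i \<noteq> 0}. q i * f ^ i)"
      by (rule sum.mono_neutral_right) auto
    finally have fS2: "f * S = (\<Sum>i\<in>{i\<in>{1..<k}. q i \<noteq> 0}. q i * f ^ i)" (is "_ = sum _ ?I")
      using QS by simp
    have "f * S \<noteq> 0" using \<open>S \<noteq> 0\<close> less.prems by simp
    then have ne: "?I \<noteq> {}" unfolding fS2 by (metis (no_types, lifting) sum.empty)
    have tv: "\<exists>b\<in>Gam \<nu>. \<nu> (q i * f ^ i) = Fin (b + nsm i a)" if "i \<in> ?I" for i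
    proof -
      have "q i \<noteq> 0" "degree (q i) < m" using that dq[of i] less.prems(1) by auto
      then obtain b where b: "\<nu> (q i) = Fin b" using small_finite_value by blast
      then show ?thesis
        using qGam[OF \<open>q i \<noteq> 0\<close> b] nu_power[OF less.prems(3), of i] by (auto simp: nu_mult)
    qed
    show ?thesis
    proof (rule ccontr)
      assume na: "a \<notin> Gam \<nu>"
      \<comment> \<open>Two equal values would put a positive multiple of \<open>a\<close> into
        \<open>Gam\<close>.\<close>
      have neq: False if ij: "i < j" "\<nu> (q i * f ^ i) = \<nu> (q j * f ^ j)" "i \<in> ?I" "j \<in> ?I" for i j
      proof -
        obtain b c where bc: "b \<in> Gam \<nu>" "c \<in> Gam \<nu>" "b + nsm i a = c + nsm j a"
          using tv[OF ij(3)] tv[OF ij(4)] ij(2) by auto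
        have "nsm j a = nsm (j - i) a + nsm i a" using \<open>i < j\<close> by (simp flip: nsm_add)
        then have "nsm (j - i) a = b - c" using bc(3) by (simp add: algebra_simps)
        then have "nsm (j - i) a \<in> Gam \<nu>" using bc Gam_diff by simp
        then show False using na Gam_nsm_cancel[of "j - i" a] \<open>i < j\<close> by simp
      qed
      have "inj_on (\<lambda>i. \<nu> (q i * f ^ i)) ?I"
        by (rule linorder_inj_onI') (use neq in blast)
      from nu_sum_distinct_values[OF _ ne this] obtain i
        where i: "i \<in> ?I" "\<nu> (f * S) = \<nu> (q i * f ^ i)" unfolding fS2 by auto
      obtain b where b: "b \<in> Gam \<nu>" "\<nu> (q i * f ^ i) = Fin (b + nsm i a)" using tv[OF i(1)] by auto
      \<comment> \<open>The dominating term has the value \<open>a + \<sigma>\<close> of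
        \<open>q 0\<close>, which is in \<open>Gam\<close> by induction; its index \<open>i\<close>
        is positive.\<close>
      have "nsm i a = (a + \<sigma>) - b" using i(2) b(2) fS q0 by (simp add: algebra_simps)
      moreover have "a + \<sigma> \<in> Gam \<nu>" using qGam[OF \<open>q 0 \<noteq> 0\<close> q0] .
      ultimately have "nsm i a \<in> Gam \<nu>" using b(1) Gam_diff by simp
      then show False using na Gam_nsm_cancel[of i a] i(1) by simp
    qed
  qed
qed

text \<open>Subtracting a key polynomial of larger value keeps the value of \<open>Q\<close> and
  brings the degree below \<open>m\<close>.\<close>

lemma Psi_value_in_Gam:
  assumes Q: "Q \<in> Psi \<nu> m" and g: "\<nu> Q = Fin g"
  shows "g \<in> Gam \<nu>"
proof -
  obtain R where R: "R \<in> Psi \<nu> m" "\<nu> Q < \<nu> R" using Psi_nomax Q by blast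
  have "\<nu> (Q - R) = Fin g" using nu_diff_eq[OF R(2)] g by simp
  moreover have "degree (Q - R) < m"
    using Psi_degree_diff[OF Q R(1)] .
  ultimately show ?thesis using small_value_in_Gam[of "Q - R" g] by fastforce
qed

end

section \<open>Weights on expansions\<close>

context polynomial_valuation
begin

text \<open>Says that the weight of \<open>f\<close> is at least \<open>t\<close>, without forming a
  minimum. The weight \<open>g\<close> is independent of \<open>\<nu> R\<close>, so expansions in
  different keys can be compared at one common weight.\<close>

definition wge :: "'k poly \<Rightarrow> 'g \<Rightarrow> 'g \<Rightarrow> 'k poly \<Rightarrow> bool" where
  "wge R g t f \<longleftrightarrow> (\<forall>i. Fin t \<le> \<nu> (qcoeff R f i) + Fin (nsm i g))"

lemma wge_iff: "wge R g t f \<longleftrightarrow> (\<forall>i. Fin (t - nsm i g) \<le> \<nu> (qcoeff R f i))"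
  by (simp add: wge_def Fin_le_add_Fin)

lemma wge_0 [simp]: "wge R g t 0"
  by (simp add: wge_iff)

lemma wge_add: "wge R g t f \<Longrightarrow> wge R g t h \<Longrightarrow> wge R g t (f + h)"
  by (simp add: wge_iff qcoeff_add nu_add_ge)

lemma wge_diff: "wge R g t f \<Longrightarrow> wge R g t h \<Longrightarrow> wge R g t (f - h)"
  by (simp add: wge_iff qcoeff_diff nu_diff_ge)

lemma wge_sum: "(\<And>x. x \<in> A \<Longrightarrow> wge R g t (f x)) \<Longrightarrow> wge R g t (\<Sum>x\<in>A. f x)"
  by (induction A rule: infinite_finite_induct) (simp_all add: wge_add)

lemma wge_of_nat_mult: "wge R g t f \<Longrightarrow> wge R g t (of_nat n * f)"
  by (induction n) (simp_all add: distrib_right wge_add)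

lemma wge_small:
  assumes "degree f < degree R"
  shows "wge R g t f \<longleftrightarrow> Fin t \<le> \<nu> f"
proof -
  have "(\<forall>i. Fin (t - nsm i g) \<le> \<nu> (if i = 0 then f else 0)) \<longleftrightarrow> Fin t \<le> \<nu> f"
    by (auto dest: spec[of _ 0])
  then show ?thesis unfolding wge_iff using qcoeff_small[OF assms] by simp
qed

lemma wge_mult_power:
  assumes "0 < degree R" "wge R g t f"
  shows "wge R g (t + nsm k g) (f * R ^ k)"
  unfolding wge_iff
proof
  fix i
  have "nsm i g = nsm k g + nsm (i - k) g" if "k \<le> i"
    using that by (simp flip: nsm_add)
  then show "Fin (t + nsm k g - nsm i g) \<le> \<nu> (qcoeff R (f * R ^ k) i)"
    using assms by (auto simp: qcoeff_mult_power wge_iff not_less)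
qed

lemma wge_weight_mono: "wge R g t f \<Longrightarrow> g \<le> g' \<Longrightarrow> wge R g' t f"
  unfolding wge_iff
proof
  fix i assume "\<forall>i. Fin (t - nsm i g) \<le> \<nu> (qcoeff R f i)" "g \<le> g'"
  then have "Fin (t - nsm i g) \<le> \<nu> (qcoeff R f i)" "t - nsm i g' \<le> t - nsm i g"
    by (simp_all add: nsm_mono)
  then show "Fin (t - nsm i g') \<le> \<nu> (qcoeff R f i)"
    by (auto intro: order_trans[of _ "Fin (t - nsm i g)"])
qed

text \<open>Multiplying out the two expansions leaves products of two digits times a power of
  \<open>R\<close>; \<open>good\<close> isolates that case.\<close>

lemma wge_mult:
  assumes R: "0 < degree R"
    and good: "\<And>a b t. degree a < degree R \<Longrightarrow> degree b < degree R \<Longrightarrow> Fin t \<le> \<nu> (a * b) \<Longrightarrow>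
      wge R g t (a * b)"
    and f: "wge R g s f" and h: "wge R g t h"
  shows "wge R g (s + t) (f * h)"
proof -
  define k where "k = Suc (degree f + degree h)"
  have "degree f < k * degree R" "degree h < k * degree R"
    using R by (cases "degree R"; simp add: k_def)+
  then have "f = (\<Sum>i<k. qcoeff R f i * R ^ i)" "h = (\<Sum>j<k. qcoeff R h j * R ^ j)"
    using expansion_eq[OF R] by blast+
  then have "f * h = (\<Sum>i<k. qcoeff R f i * R ^ i) * (\<Sum>j<k. qcoeff R h j * R ^ j)"
    by simp
  also have "\<dots> = (\<Sum>i<k. \<Sum>j<k. (qcoeff R f i * qcoeff R h j) * R ^ (i + j))"
    unfolding sum_product by (simp add: power_add mult_ac)
  finally have eq: "f * h = \<dots>" .
  have "wge R g (s + t) ((qcoeff R f i * qcoeff R h j) * R ^ (i + j))" for i j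
  proof -
    have "Fin (s - nsm i g) \<le> \<nu> (qcoeff R f i)" "Fin (t - nsm j g) \<le> \<nu> (qcoeff R h j)"
      using f h by (simp_all add: wge_iff)
    then have "Fin ((s - nsm i g) + (t - nsm j g)) \<le> \<nu> (qcoeff R f i * qcoeff R h j)"
      by (rule nu_mult_ge)
    then have "wge R g ((s - nsm i g) + (t - nsm j g)) (qcoeff R f i * qcoeff R h j)"
      using degree_qcoeff[OF R] by (intro good) auto
    from wge_mult_power[OF R this, of "i + j"] show ?thesis
      by (simp add: nsm_add algebra_simps)
  qed
  then show ?thesis unfolding eq by (intro wge_sum)
qed

end

context key_polynomial_family
begin

text \<open>The product has only the digits \<open>d\<close> and \<open>c\<close> in base
  \<open>R\<close>, and \<open>key_mult\<close> for \<open>R\<close> settles \<open>d\<close>. For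
  \<open>c\<close> it gives a bound with \<open>\<nu> R\<close> in place of the smaller
  \<open>g\<close>, so the product is expanded in \<open>Q\<close> instead: with
  \<open>R = Q + h\<close> the quotient by \<open>Q\<close> is \<open>c + c'\<close>, where
  \<open>c'\<close> comes from reducing \<open>c * h\<close> and has larger value than
  \<open>c\<close>. Then \<open>key_mult\<close> for \<open>Q\<close> bounds
  \<open>\<nu> c + g\<close>.\<close>

lemma wge_key_small_mult:
  assumes Q: "Q \<in> Psi \<nu> m" and R: "R \<in> Psi \<nu> m" and g: "\<nu> Q = Fin g" and le: "\<nu> Q \<le> \<nu> R"
    and a: "degree a < m" and b: "degree b < m" and t: "Fin t \<le> \<nu> (a * b)"
  shows "wge R g t (a * b)"
proof (cases "a = 0 \<or> b = 0")
  case False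
  then have a0: "a \<noteq> 0" and b0: "b \<noteq> 0" by auto
  define c d h where "c = (a * b) div R" and "d = (a * b) mod R" and "h = R - Q"
  have dR: "degree R = m" and dQ: "degree Q = m" using Psi_degree Q R by auto
  have nz: "Q \<noteq> 0" "R \<noteq> 0" using dR dQ m_pos by auto
  have dc: "degree c < m"
    using a b dR nz a0 b0 by (simp add: c_def degree_div_eq degree_mult_eq)
  have dd: "degree d < m"
    unfolding d_def using dR nz degree_mod_less[of R "a * b"] m_pos by auto
  have dh: "degree h < m" unfolding h_def by (rule Psi_degree_diff[OF R Q])
  have ab: "a * b = c * R + d" by (simp add: c_def d_def)
  have nd: "Fin t \<le> \<nu> d" using key_mult(1)[OF R a a0 b b0] t by (simp add: d_def)
  have nc: "Fin t \<le> \<nu> c + Fin g"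
  proof (cases "c = 0")
    case c0: False
    define c' d' where "c' = (c * h) div Q" and "d' = (c * h) mod Q"
    have less: "\<nu> c < \<nu> c'"
    proof (cases "h = 0")
      case True
      then show ?thesis using small_finite_value[OF dc c0] by (auto simp: c'_def)
    next
      case h0: False
      have "Fin g \<le> \<nu> h" using nu_diff_ge[of "Fin g" R Q] g le by (simp add: h_def)
      obtain \<kappa> where \<kappa>: "\<nu> c = Fin \<kappa>" using small_finite_value[OF dc c0] by blast
      then have "Fin (\<kappa> + g) \<le> \<nu> (c * h)" using nu_mult_ge[of \<kappa> c g h] \<open>Fin g \<le> \<nu> h\<close> by simp
      also have "\<dots> < \<nu> (c' * Q)" using key_mult(2)[OF Q dc c0 dh h0] by (simp add: c'_def)
      finally show ?thesis using \<kappa> g by (cases "\<nu> c'") (simp_all add: nu_mult)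
    qed
    have "a * b = c * Q + c * h + d" using ab by (simp add: h_def algebra_simps)
    also have "c * h = c' * Q + d'" by (simp add: c'_def d'_def)
    finally have "a * b = (d' + d) + (c + c') * Q" by (simp add: algebra_simps)
    moreover have "degree (d' + d) < degree Q"
      using dd dQ m_pos nz degree_mod_less[of Q "c * h"] by (intro degree_add_less) (auto simp: d'_def)
    ultimately have "(a * b) div Q = c + c'"
      using nz by (simp add: div_poly_less)
    then have "\<nu> (a * b) < \<nu> ((c + c') * Q)" using key_mult(2)[OF Q a a0 b b0] by simp
    also have "\<dots> = \<nu> c + Fin g" using nu_add_eq[OF less] g by (simp add: nu_mult)
    finally show ?thesis using t by simp
  qed simp
  show ?thesis
    unfolding wge_def
  proof
    fix i :: nat
    consider "i = 0" | "i = 1" | j where "i = Suc (Suc j)" by (cases i rule: nat.exhaust; cases "i - 1") auto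
    then show "Fin t \<le> \<nu> (qcoeff R (a * b) i) + Fin (nsm i g)"
    proof cases
      case 1
      then show ?thesis using nd by (simp add: d_def Fin_le_add_Fin)
    next
      case 2
      then show ?thesis using nc dc dR by (simp add: qcoeff_Suc mod_poly_less flip: c_def)
    next
      case 3
      then show ?thesis using dc dR by (simp add: qcoeff_Suc div_poly_less flip: c_def)
    qed
  qed
qed auto

lemma wge_key_mult:
  assumes "Q \<in> Psi \<nu> m" "R \<in> Psi \<nu> m" "\<nu> Q = Fin g" "\<nu> Q \<le> \<nu> R"
    and "wge R g s f" "wge R g t h"
  shows "wge R g (s + t) (f * h)"
  using assms m_pos Psi_degree[OF assms(2)] wge_key_small_mult[OF assms(1-4)]
  by (intro wge_mult) auto

lemma wge_key_power:
  assumes "Q \<in> Psi \<nu> m" "R \<in> Psi \<nu> m" "\<nu> Q = Fin g" "\<nu> Q \<le> \<nu> R"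
    and "wge R g s f"
  shows "wge R g (nsm n s) (f ^ n)"
proof (induction n)
  case 0
  then show ?case using m_pos Psi_degree[OF assms(2)] by (simp add: wge_small)
qed (simp add: wge_key_mult[OF assms])

text \<open>Both \<open>R\<close> and the small polynomial \<open>R - A\<close> have weight at least
  \<open>g\<close> in base \<open>R\<close>, hence so does \<open>A\<close>; multiplicativity
  carries the \<open>A\<close>-expansion over term by term. The order of \<open>A\<close> and
  \<open>R\<close> is free as long as both values are at least \<open>g\<close>.\<close>

lemma wge_change_key:
  assumes Q: "Q \<in> Psi \<nu> m" and g: "\<nu> Q = Fin g"
    and A: "A \<in> Psi \<nu> m" "\<nu> Q \<le> \<nu> A" and R: "R \<in> Psi \<nu> m" "\<nu> Q \<le> \<nu> R"
    and f: "wge A g t f"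
  shows "wge R g t f"
proof -
  have dR: "degree R = m" and dA: "degree A = m" using Psi_degree A R by auto
  have pos: "0 < degree R" "0 < degree A" using dR dA m_pos by simp_all
  have "wge R g 0 1" using pos by (simp add: wge_small)
  from wge_mult_power[OF pos(1) this, of 1] have "wge R g g R" by simp
  moreover have "wge R g g (R - A)"
    using wge_small[of "R - A" R g g] Psi_degree_diff[OF R(1) A(1)] dR nu_diff_ge[of "Fin g" R A] g A(2) R(2)
    by simp
  ultimately have "wge R g g (R - (R - A))" by (rule wge_diff)
  then have wA: "wge R g g A" by simp
  define k where "k = Suc (degree f)"
  have "degree f < k * degree A" using pos by (cases "degree A"; simp add: k_def)
  from expansion_eq[OF pos(2) this] have eq: "f = (\<Sum>i<k. qcoeff A f i * A ^ i)" .
  have "wge R g t (qcoeff A f i * A ^ i)" for i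
  proof -
    have "wge R g (t - nsm i g) (qcoeff A f i)"
      using f degree_qcoeff[OF pos(2), of f i] dR dA
      by (subst wge_small) (simp_all add: wge_iff)
    from wge_key_mult[OF Q R(1) g R(2) this wge_key_power[OF Q R(1) g R(2) wA, of i]]
    show ?thesis by simp
  qed
  then show ?thesis by (subst eq) (rule wge_sum)
qed

section \<open>The truncation \<open>\<nu>\<^sub>Q\<close> for a fixed key polynomial\<close>

context
  fixes Q g
  assumes Q: "Q \<in> Psi \<nu> m" and g: "\<nu> Q = Fin g"
begin

lemma nu_qcoeff_term: "\<nu> (qcoeff Q f i * Q ^ i) = \<nu> (qcoeff Q f i) + Fin (nsm i g)"
  using nu_power[OF g] by (simp add: nu_mult)

lemma degree_Q_pos: "0 < degree Q"
  using Psi_degree[OF Q] m_pos by simp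

text \<open>Makes \<open>Min\<close> over the infinite index range in \<open>nuQ\<close> meaningful:
  digits beyond the degree vanish and contribute only \<open>Pinf\<close>.\<close>

lemma finite_qcoeff_values: "finite (range (\<lambda>i. \<nu> (qcoeff Q f i * Q ^ i)))"
proof (rule finite_subset)
  have "\<nu> (qcoeff Q f i * Q ^ i) \<in> insert Pinf ((\<lambda>i. \<nu> (qcoeff Q f i * Q ^ i)) ` {..degree f})" for i
  proof (cases "degree f < i")
    case True
    then have "degree f < i * degree Q" using degree_Q_pos by (cases "degree Q") simp_all
    then show ?thesis by (simp add: qcoeff_beyond)
  qed simp
  then show "range (\<lambda>i. \<nu> (qcoeff Q f i * Q ^ i))
      \<subseteq> insert Pinf ((\<lambda>i. \<nu> (qcoeff Q f i * Q ^ i)) ` {..degree f})" by blast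
qed simp

lemma nuQ_le: "nuQ \<nu> Q f \<le> \<nu> (qcoeff Q f i) + Fin (nsm i g)"
  unfolding nuQ_def nu_qcoeff_term[symmetric] by (rule Min_le[OF finite_qcoeff_values]) simp

lemma nuQ_attained: "\<exists>i. nuQ \<nu> Q f = \<nu> (qcoeff Q f i) + Fin (nsm i g)"
proof -
  have "nuQ \<nu> Q f \<in> range (\<lambda>i. \<nu> (qcoeff Q f i * Q ^ i))"
    unfolding nuQ_def by (rule Min_in[OF finite_qcoeff_values]) simp
  then show ?thesis by (auto simp: nu_qcoeff_term)
qed

lemma nuQ_geI: "(\<And>i. x \<le> \<nu> (qcoeff Q f i) + Fin (nsm i g)) \<Longrightarrow> x \<le> nuQ \<nu> Q f"
  using nuQ_attained[of f] by auto

lemma nuQ_gtI: "(\<And>i. x < \<nu> (qcoeff Q f i) + Fin (nsm i g)) \<Longrightarrow> x < nuQ \<nu> Q f"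
  using nuQ_attained[of f] by auto

lemma nuQ_ge_iff_wge: "Fin t \<le> nuQ \<nu> Q f \<longleftrightarrow> wge Q g t f"
  unfolding wge_def by (auto intro: nuQ_geI order_trans[OF _ nuQ_le])

lemma wge_nuQ: "nuQ \<nu> Q f = Fin t \<Longrightarrow> wge Q g t f"
  using nuQ_ge_iff_wge[of t f] by simp

lemma nuQ_not_Minf: "nuQ \<nu> Q f \<noteq> Minf"
proof -
  obtain i where "nuQ \<nu> Q f = \<nu> (qcoeff Q f i) + Fin (nsm i g)" using nuQ_attained by blast
  then show ?thesis by (cases "\<nu> (qcoeff Q f i)") auto
qed

lemma nuQ_zero: "nuQ \<nu> Q 0 = Pinf"
  using nuQ_attained[of 0] by simp

lemma Q_expansion: "f = (\<Sum>i<Suc (degree f). qcoeff Q f i * Q ^ i)"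
proof -
  have "degree f < Suc (degree f) * degree Q" using degree_Q_pos by (cases "degree Q") simp_all
  from expansion_eq[OF degree_Q_pos this] show ?thesis .
qed

lemma nuQ_eq_Pinf: "nuQ \<nu> Q f = Pinf \<longleftrightarrow> f = 0"
proof
  assume P: "nuQ \<nu> Q f = Pinf"
  have "qcoeff Q f i = 0" for i
  proof -
    have "\<nu> (qcoeff Q f i) = Pinf" using nuQ_le[of f i] P by (cases "\<nu> (qcoeff Q f i)") simp_all
    moreover have "degree (qcoeff Q f i) < m" using degree_qcoeff[OF degree_Q_pos] Psi_degree[OF Q] by simp
    ultimately show ?thesis using small_value_eq_Pinf by simp
  qed
  then show "f = 0" by (subst Q_expansion[of f]) simp
qed (simp add: nuQ_zero)

lemma nuQ_finite: "f \<noteq> 0 \<Longrightarrow> \<exists>t. nuQ \<nu> Q f = Fin t"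
  using nuQ_eq_Pinf[of f] nuQ_not_Minf[of f] by (cases "nuQ \<nu> Q f") auto

lemma nuQ_le_nu: "nuQ \<nu> Q f \<le> \<nu> f"
proof -
  have "nuQ \<nu> Q f \<le> \<nu> (\<Sum>i<Suc (degree f). qcoeff Q f i * Q ^ i)"
    by (rule nu_sum_ge) (simp only: nu_qcoeff_term nuQ_le)
  then show ?thesis using Q_expansion[of f] by simp
qed

lemma nuQ_add_ge:
  assumes "x \<le> nuQ \<nu> Q f" "x \<le> nuQ \<nu> Q h"
  shows "x \<le> nuQ \<nu> Q (f + h)"
proof (rule nuQ_geI)
  fix i
  have "x \<le> \<nu> (qcoeff Q f i) + Fin (nsm i g)" "x \<le> \<nu> (qcoeff Q h i) + Fin (nsm i g)"
    using order_trans[OF assms(1) nuQ_le] order_trans[OF assms(2) nuQ_le] by blast+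
  then show "x \<le> \<nu> (qcoeff Q (f + h) i) + Fin (nsm i g)"
    unfolding extended_le_plus_Fin_iff qcoeff_add by (rule nu_add_ge)
qed

lemma nuQ_add_gt:
  assumes "x < nuQ \<nu> Q f" "x < nuQ \<nu> Q h"
  shows "x < nuQ \<nu> Q (f + h)"
proof (rule nuQ_gtI)
  fix i
  have "x < \<nu> (qcoeff Q f i) + Fin (nsm i g)" "x < \<nu> (qcoeff Q h i) + Fin (nsm i g)"
    using less_le_trans[OF assms(1) nuQ_le] less_le_trans[OF assms(2) nuQ_le] by blast+
  then show "x < \<nu> (qcoeff Q (f + h) i) + Fin (nsm i g)"
    unfolding extended_less_plus_Fin_iff qcoeff_add by (rule nu_add_gt)
qed

lemma nuQ_uminus: "nuQ \<nu> Q (- f) = nuQ \<nu> Q f"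
proof -
  have "qcoeff Q (- f) i = - qcoeff Q f i" for i using qcoeff_diff[of Q 0 f i] by simp
  then show ?thesis by (simp add: nuQ_def)
qed

lemma nuQ_add_eq: "nuQ \<nu> Q f < nuQ \<nu> Q h \<Longrightarrow> nuQ \<nu> Q (f + h) = nuQ \<nu> Q f"
  using nuQ_add_ge[of "nuQ \<nu> Q f" f h] nuQ_add_gt[of "nuQ \<nu> Q f" "f + h" "- h"]
  by (force simp: not_less nuQ_uminus)

lemma nuQ_diff_eq: "nuQ \<nu> Q f < nuQ \<nu> Q h \<Longrightarrow> nuQ \<nu> Q (f - h) = nuQ \<nu> Q f"
  using nuQ_add_eq[of f "- h"] by (simp add: nuQ_uminus)

lemma nuQ_mult_ge: "nuQ \<nu> Q f + nuQ \<nu> Q h \<le> nuQ \<nu> Q (f * h)"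
proof (cases "f = 0 \<or> h = 0")
  case False
  then obtain s t where st: "nuQ \<nu> Q f = Fin s" "nuQ \<nu> Q h = Fin t" using nuQ_finite by blast
  then have "wge Q g s f" "wge Q g t h" using wge_nuQ by blast+
  then have "wge Q g (s + t) (f * h)" using wge_key_mult[OF Q Q g] by simp
  then show ?thesis using st nuQ_ge_iff_wge by simp
qed (auto simp: nuQ_zero)

lemma nuQ_small: "degree f < m \<Longrightarrow> nuQ \<nu> Q f = \<nu> f"
proof -
  assume d: "degree f < m"
  then have "\<nu> f \<le> nuQ \<nu> Q f"
    using Psi_degree[OF Q] by (intro nuQ_geI) (cases "\<nu> f", simp_all add: qcoeff_small)
  then show ?thesis using nuQ_le_nu[of f] by simp
qed

lemma nuQ_small_mult_power:
  assumes "degree a < m"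
  shows "nuQ \<nu> Q (a * Q ^ l) = \<nu> a + Fin (nsm l g)"
proof -
  have "\<nu> a + Fin (nsm l g) \<le> nuQ \<nu> Q (a * Q ^ l)"
    using Psi_degree[OF Q] assms
    by (intro nuQ_geI) (auto simp: qcoeff_mult_power[OF degree_Q_pos] qcoeff_small)
  moreover have "nuQ \<nu> Q (a * Q ^ l) \<le> \<nu> a + Fin (nsm l g)"
    using nuQ_le_nu[of "a * Q ^ l"] nu_power[OF g] by (simp add: nu_mult)
  ultimately show ?thesis by simp
qed

end

text \<open>First the key is exchanged at the smaller weight \<open>g\<close>, then the weight is
  raised.\<close>

lemma nuQ_mono:
  assumes Q: "Q \<in> Psi \<nu> m" and R: "R \<in> Psi \<nu> m" and le: "\<nu> Q \<le> \<nu> R"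
  shows "nuQ \<nu> Q f \<le> nuQ \<nu> R f"
proof (cases "f = 0")
  case False
  obtain g where g: "\<nu> Q = Fin g" using Psi_finite_value[OF Q] by blast
  obtain g' where g': "\<nu> R = Fin g'" using Psi_finite_value[OF R] by blast
  obtain t where t: "nuQ \<nu> Q f = Fin t" using nuQ_finite[OF Q g False] by blast
  then have "wge Q g t f" by (rule wge_nuQ[OF Q g])
  then have "wge R g t f" by (rule wge_change_key[OF Q g Q order_refl R le])
  then have "wge R g' t f" by (rule wge_weight_mono) (use le g g' in simp)
  then show ?thesis using t nuQ_ge_iff_wge[OF R g'] by simp
next
  case True
  then show ?thesis using Psi_finite_value[OF R] nuQ_zero[OF R] by auto
qed

text \<open>All terms of the \<open>R\<close>-expansion are at least \<open>t\<close> at weight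
  \<open>\<nu> Q\<close>. Raising the weight to \<open>\<nu> R\<close> pushes every term of positive
  index strictly above \<open>t\<close>, so only the constant digit can attain the minimum and it
  dominates the sum.\<close>

lemma nuQ_eq_imp_nu_eq:
  assumes Q: "Q \<in> Psi \<nu> m" and R: "R \<in> Psi \<nu> m" and less: "\<nu> Q < \<nu> R"
    and eq: "nuQ \<nu> Q f = nuQ \<nu> R f"
  shows "nuQ \<nu> R f = \<nu> f \<and> \<nu> (f mod R) = \<nu> f"
proof (cases "f = 0")
  case True
  then show ?thesis using Psi_finite_value[OF R] nuQ_zero[OF R] by auto
next
  case False
  obtain g where g: "\<nu> Q = Fin g" using Psi_finite_value[OF Q] by blast
  obtain g' where g': "\<nu> R = Fin g'" using Psi_finite_value[OF R] by blast
  have gg: "g < g'" using less g g' by simp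
  obtain t where t: "nuQ \<nu> Q f = Fin t" using nuQ_finite[OF Q g False] by blast
  then have "wge Q g t f" by (rule wge_nuQ[OF Q g])
  then have w: "wge R g t f" by (rule wge_change_key[OF Q g Q order_refl R less_imp_le[OF less]])
  have gt: "Fin t < \<nu> (qcoeff R f i) + Fin (nsm i g')" if "0 < i" for i
  proof -
    have "Fin t \<le> \<nu> (qcoeff R f i) + Fin (nsm i g)" using w by (simp add: wge_def)
    moreover have "nsm i g < nsm i g'" using nsm_strict_mono[OF gg that] .
    ultimately show ?thesis
      by (cases "\<nu> (qcoeff R f i)") (auto intro: le_less_trans)
  qed
  obtain i where i: "nuQ \<nu> R f = \<nu> (qcoeff R f i) + Fin (nsm i g')"
    using nuQ_attained[OF R g'] by blast
  then have "i = 0" using gt[of i] t eq by fastforce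
  then have m0: "\<nu> (f mod R) = Fin t" using i t eq by (cases "\<nu> (f mod R)") simp_all
  have "f = f mod R + (\<Sum>i<degree f. qcoeff R f (Suc i) * R ^ Suc i)"
    using Q_expansion[OF R g', of f] unfolding sum.lessThan_Suc_shift by simp
  moreover have "Fin t < \<nu> (\<Sum>i<degree f. qcoeff R f (Suc i) * R ^ Suc i)"
    by (rule nu_sum_gt) (simp_all only: nu_qcoeff_term[OF R g'] gt zero_less_Suc less_extended_simps)
  ultimately have "\<nu> f = Fin t"
    using nu_add_eq[of "f mod R" "\<Sum>i<degree f. qcoeff R f (Suc i) * R ^ Suc i"] m0 by simp
  then show ?thesis using m0 t eq by simp
qed

end

section \<open>Stability and limit key polynomials\<close>

context key_polynomial_family
begin

lemma QQ_Psi: "Q \<in> QQ \<Longrightarrow> Q \<in> Psi \<nu> m"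
  using QQ_sub by blast

lemma QQ_degree: "Q \<in> QQ \<Longrightarrow> degree Q = m"
  and QQ_finite_value: "Q \<in> QQ \<Longrightarrow> \<exists>g. \<nu> Q = Fin g"
  using QQ_Psi Psi_degree Psi_finite_value by blast+

lemma QQ_degree_pos: "Q \<in> QQ \<Longrightarrow> 0 < degree Q"
  using QQ_degree m_pos by fastforce

lemma QQ_ne: "QQ \<noteq> {}"
  using Psi_ne QQ_cof by blast

lemma QQ_nomax: "Q \<in> QQ \<Longrightarrow> \<exists>R\<in>QQ. \<nu> Q < \<nu> R"
  using Psi_nomax QQ_cof QQ_Psi[of Q] by (blast intro: less_le_trans)

lemma ev_Q_mono: "ev_Q \<nu> QQ P \<Longrightarrow> (\<And>Q. Q \<in> QQ \<Longrightarrow> P Q \<Longrightarrow> P' Q) \<Longrightarrow> ev_Q \<nu> QQ P'"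
  unfolding ev_Q_def by blast

lemma ev_Q_cong: "(\<And>Q. Q \<in> QQ \<Longrightarrow> P Q \<longleftrightarrow> P' Q) \<Longrightarrow> ev_Q \<nu> QQ P \<longleftrightarrow> ev_Q \<nu> QQ P'"
  unfolding ev_Q_def by blast

lemma ev_Q_conj:
  assumes "ev_Q \<nu> QQ P" "ev_Q \<nu> QQ P'"
  shows "ev_Q \<nu> QQ (\<lambda>Q. P Q \<and> P' Q)"
proof -
  obtain A where "A \<in> QQ" and A: "\<forall>Q\<in>QQ. \<nu> A \<le> \<nu> Q \<longrightarrow> P Q"
    using assms(1) unfolding ev_Q_def by blast
  obtain B where "B \<in> QQ" and B: "\<forall>Q\<in>QQ. \<nu> B \<le> \<nu> Q \<longrightarrow> P' Q"
    using assms(2) unfolding ev_Q_def by blast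
  define C where "C = (if \<nu> A \<le> \<nu> B then B else A)"
  have "C \<in> QQ" "\<nu> A \<le> \<nu> C" "\<nu> B \<le> \<nu> C"
    using \<open>A \<in> QQ\<close> \<open>B \<in> QQ\<close> by (auto simp: C_def)
  then show ?thesis unfolding ev_Q_def using A B by (intro bexI[of _ C]) auto
qed

lemma ev_Q_True: "ev_Q \<nu> QQ (\<lambda>_. True)"
  using QQ_ne unfolding ev_Q_def by blast

lemma ev_Q_Ball:
  "finite A \<Longrightarrow> (\<And>x. x \<in> A \<Longrightarrow> ev_Q \<nu> QQ (P x)) \<Longrightarrow> ev_Q \<nu> QQ (\<lambda>Q. \<forall>x\<in>A. P x Q)"
proof (induction A rule: finite_induct)
  case (insert x A)
  then have "ev_Q \<nu> QQ (\<lambda>Q. P x Q \<and> (\<forall>y\<in>A. P y Q))" by (intro ev_Q_conj) auto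
  then show ?case by (rule ev_Q_mono) auto
qed (simp add: ev_Q_True)

lemma ev_Q_ge: "Q \<in> QQ \<Longrightarrow> ev_Q \<nu> QQ (\<lambda>R. \<nu> Q \<le> \<nu> R)"
  unfolding ev_Q_def by blast

lemma ev_Q_gt: "Q \<in> QQ \<Longrightarrow> ev_Q \<nu> QQ (\<lambda>R. \<nu> Q < \<nu> R)"
  using QQ_nomax[of Q] unfolding ev_Q_def by (auto intro: less_le_trans)

lemma ev_Q_ex: "ev_Q \<nu> QQ P \<Longrightarrow> \<exists>Q\<in>QQ. P Q"
  unfolding ev_Q_def by blast

lemma not_ev_Q_cofinal:
  assumes "\<not> ev_Q \<nu> QQ P" "ev_Q \<nu> QQ P'"
  shows "\<exists>Q\<in>QQ. \<not> P Q \<and> P' Q"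
  using assms ev_Q_mono[of P' P] by blast

lemma nuQ_mono_QQ: "Q \<in> QQ \<Longrightarrow> R \<in> QQ \<Longrightarrow> \<nu> Q \<le> \<nu> R \<Longrightarrow> nuQ \<nu> Q f \<le> nuQ \<nu> R f"
  by (intro nuQ_mono QQ_Psi)

lemma nuQ_le_nu_QQ: "Q \<in> QQ \<Longrightarrow> nuQ \<nu> Q f \<le> \<nu> f"
  using nuQ_le_nu QQ_Psi QQ_finite_value by blast

text \<open>The truncated values increase and are bounded by \<open>\<nu> f\<close>, so equality
  persists once reached.\<close>

lemma stable_if_nuQ_eq_nu: "Q \<in> QQ \<Longrightarrow> nuQ \<nu> Q f = \<nu> f \<Longrightarrow> stable \<nu> QQ f"
  unfolding stable_def ev_Q_def
  using nuQ_mono_QQ[of Q _ f] nuQ_le_nu_QQ[of _ f] by (intro bexI[of _ Q]) (auto intro: antisym)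

lemma unstable_strict:
  assumes "\<not> stable \<nu> QQ f" "Q \<in> QQ" "R \<in> QQ" "\<nu> Q < \<nu> R"
  shows "nuQ \<nu> Q f < nuQ \<nu> R f"
proof (rule ccontr)
  assume "\<not> ?thesis"
  moreover have "nuQ \<nu> Q f \<le> nuQ \<nu> R f" using assms by (intro nuQ_mono_QQ) simp_all
  ultimately have "nuQ \<nu> R f = \<nu> f"
    using nuQ_eq_imp_nu_eq[of Q R f] assms QQ_Psi by fastforce
  then show False using stable_if_nuQ_eq_nu assms(1,3) by blast
qed

text \<open>Two different keys past stabilization give the same truncated value, so
  \<open>nuQ_eq_imp_nu_eq\<close> applies.\<close>

lemma stable_nu_mod:
  assumes "stable \<nu> QQ f"
  shows "ev_Q \<nu> QQ (\<lambda>Q. \<nu> (f mod Q) = \<nu> f)"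
proof -
  have ev: "ev_Q \<nu> QQ (\<lambda>Q. nuQ \<nu> Q f = \<nu> f)" using assms by (simp add: stable_def)
  then obtain A where A: "A \<in> QQ" "nuQ \<nu> A f = \<nu> f" using ev_Q_ex by blast
  from ev_Q_conj[OF ev ev_Q_gt[OF A(1)]] show ?thesis
  proof (rule ev_Q_mono)
    fix Q assume "Q \<in> QQ" "nuQ \<nu> Q f = \<nu> f \<and> \<nu> A < \<nu> Q"
    then show "\<nu> (f mod Q) = \<nu> f" using nuQ_eq_imp_nu_eq[of A Q f] A QQ_Psi by simp
  qed
qed

lemma stable_mult:
  assumes "stable \<nu> QQ f" "stable \<nu> QQ h"
  shows "stable \<nu> QQ (f * h)"
proof -
  obtain Q where Q: "Q \<in> QQ" "nuQ \<nu> Q f = \<nu> f" "nuQ \<nu> Q h = \<nu> h"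
    using ev_Q_ex[OF ev_Q_conj] assms unfolding stable_def by blast
  obtain g where g: "\<nu> Q = Fin g" using QQ_finite_value Q(1) by blast
  have "\<nu> (f * h) \<le> nuQ \<nu> Q (f * h)"
    using nuQ_mult_ge[OF QQ_Psi[OF Q(1)] g, of f h] Q by (simp add: nu_mult)
  then have "nuQ \<nu> Q (f * h) = \<nu> (f * h)" using nuQ_le_nu_QQ[OF Q(1)] by (rule antisym[rotated])
  then show ?thesis using stable_if_nuQ_eq_nu Q(1) by blast
qed

lemma stable_small:
  assumes "degree f < m"
  shows "stable \<nu> QQ f"
proof -
  obtain Q where "Q \<in> QQ" using QQ_ne by blast
  then show ?thesis
    using nuQ_small[OF QQ_Psi _ assms] QQ_finite_value stable_if_nuQ_eq_nu by blast
qed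

lemma nuQ_small_mult_power_later:
  assumes R: "R \<in> QQ" and S: "S \<in> QQ" and le: "\<nu> R \<le> \<nu> S" and a: "degree a < m"
  shows "nuQ \<nu> S (a * R ^ l) = \<nu> (a * R ^ l)"
proof -
  obtain g where g: "\<nu> R = Fin g" using QQ_finite_value R by blast
  have "\<nu> (a * R ^ l) = nuQ \<nu> R (a * R ^ l)"
    using nuQ_small_mult_power[OF QQ_Psi[OF R] g a] nu_power[OF g] by (simp add: nu_mult)
  also have "\<dots> \<le> nuQ \<nu> S (a * R ^ l)" by (rule nuQ_mono_QQ[OF R S le])
  finally show ?thesis using nuQ_le_nu_QQ[OF S] by (rule antisym[rotated])
qed

lemma stable_key: "Q \<in> QQ \<Longrightarrow> stable \<nu> QQ Q"
  using nuQ_small_mult_power_later[of Q Q 1 1] m_pos stable_if_nuQ_eq_nu by simp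

text \<open>From \<open>Q\<close> on, \<open>h\<close> is too large in value to affect the
  truncations of \<open>f\<close>, which keep growing strictly; a stable difference would make them
  constant.\<close>

lemma unstable_diff:
  assumes f: "\<not> stable \<nu> QQ f" and Q: "Q \<in> QQ" and h: "\<And>S. S \<in> QQ \<Longrightarrow> nuQ \<nu> S f < nuQ \<nu> Q h"
  shows "\<And>R. R \<in> QQ \<Longrightarrow> \<nu> Q \<le> \<nu> R \<Longrightarrow> nuQ \<nu> R (f - h) = nuQ \<nu> R f" "\<not> stable \<nu> QQ (f - h)"
proof -
  show eq: "nuQ \<nu> R (f - h) = nuQ \<nu> R f" if R: "R \<in> QQ" "\<nu> Q \<le> \<nu> R" for R
  proof -
    have "nuQ \<nu> R f < nuQ \<nu> R h" using h[OF R(1)] nuQ_mono_QQ[OF Q R] by (rule less_le_trans)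
    then show ?thesis using nuQ_diff_eq QQ_Psi QQ_finite_value R(1) by blast
  qed
  show "\<not> stable \<nu> QQ (f - h)"
  proof
    assume "stable \<nu> QQ (f - h)"
    then have ev: "ev_Q \<nu> QQ (\<lambda>R. nuQ \<nu> R (f - h) = \<nu> (f - h) \<and> \<nu> Q \<le> \<nu> R)"
      unfolding stable_def by (rule ev_Q_conj[OF _ ev_Q_ge[OF Q]])
    then obtain R where R: "R \<in> QQ" "nuQ \<nu> R (f - h) = \<nu> (f - h)" "\<nu> Q \<le> \<nu> R" using ev_Q_ex by blast
    obtain S where S: "S \<in> QQ" "nuQ \<nu> S (f - h) = \<nu> (f - h)" "\<nu> Q \<le> \<nu> S" "\<nu> R < \<nu> S"
      using ev_Q_ex[OF ev_Q_conj[OF ev ev_Q_gt[OF R(1)]]] by blast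
    have "nuQ \<nu> R f = nuQ \<nu> S f" using eq R S by metis
    then show False using unstable_strict[OF f R(1) S(1,4)] by simp
  qed
qed

end

section \<open>Limit key polynomials and the index sets J and B\<close>

locale limit_key_polynomial = key_polynomial_family \<nu> m QQ
  for \<nu> :: "('k::field, 'g::linordered_ab_group_add) pval" and m QQ +
  fixes F :: "'k poly"
  assumes F: "F \<in> KPinf \<nu> QQ"
begin

lemma F_monic: "lead_coeff F = 1"
  and F_unstable: "\<not> stable \<nu> QQ F"
  and F_minimal: "lead_coeff G = 1 \<Longrightarrow> \<not> stable \<nu> QQ G \<Longrightarrow> degree F \<le> degree G"
  using F unfolding KPinf_def by blast+

lemma stable_if_degree_less:
  assumes "degree f < degree F"
  shows "stable \<nu> QQ f"
proof (cases "f = 0")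
  case True
  then show ?thesis using stable_small[of 0] m_pos by simp
next
  case False
  define c where "c = lead_coeff f"
  have "c \<noteq> 0" using False by (simp add: c_def)
  define f' where "f' = smult (inverse c) f"
  have "lead_coeff f' = 1" "degree f' = degree f"
    using \<open>c \<noteq> 0\<close> by (simp_all add: f'_def c_def)
  then have "stable \<nu> QQ f'" using F_minimal[of f'] assms by auto
  moreover have "stable \<nu> QQ [:c:]" using m_pos by (intro stable_small) simp
  ultimately have "stable \<nu> QQ ([:c:] * f')" using stable_mult by blast
  moreover have "[:c:] * f' = f" using \<open>c \<noteq> 0\<close> by (simp add: f'_def)
  ultimately show ?thesis by simp
qed

abbreviation D :: nat where "D \<equiv> degree F div m"

lemma degree_F_ge: "m \<le> degree F"
  using stable_small F_unstable not_less by blast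

lemma D_times_m: "D * m \<le> degree F"
  by simp

text \<open>Replaces comparison with the cut in \<open>Gam\<close> by comparison with the values
  themselves; see \<open>above_delta_iff\<close>.\<close>

definition above :: "'g extended \<Rightarrow> bool" where
  "above x \<longleftrightarrow> (\<forall>S\<in>QQ. nuQ \<nu> S F < x)"

lemma KPinf_diff:
  assumes Q: "Q \<in> QQ" and h: "above (nuQ \<nu> Q h)" and d: "degree h < degree F"
  shows "F - h \<in> KPinf \<nu> QQ" "degree (F - h) = degree F"
proof -
  have "degree (F + - h) = degree F" by (rule degree_add_eq_left) (simp add: d)
  then show deg: "degree (F - h) = degree F" by simp
  then have "lead_coeff (F - h) = 1" using F_monic d by (simp add: coeff_eq_0)
  moreover have "\<not> stable \<nu> QQ (F - h)"
    using unstable_diff(2)[OF F_unstable Q] h unfolding above_def by blast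
  ultimately show "F - h \<in> KPinf \<nu> QQ"
    unfolding KPinf_def using deg F_minimal by simp
qed

text \<open>A nonzero term has its value in \<open>Gam\<close>, because its digit and the key do; a
  zero digit gives \<open>Pinf\<close>, which exceeds every truncated value of
  \<open>F\<close>.\<close>

lemma above_delta_iff:
  assumes Q: "Q \<in> QQ"
  shows "above_delta \<nu> QQ F (\<nu> (qcoeff Q F l) + (\<Sum>_\<in>{..<l}. \<nu> Q))
     \<longleftrightarrow> above (\<nu> (qcoeff Q F l * Q ^ l))"
proof -
  obtain g where g: "\<nu> Q = Fin g" using QQ_finite_value Q by blast
  have eq: "\<nu> (qcoeff Q F l) + (\<Sum>_\<in>{..<l}. \<nu> Q) = \<nu> (qcoeff Q F l * Q ^ l)"
    using nu_qcoeff_term[OF QQ_Psi[OF Q] g] by (simp add: g sum_Fin)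
  have "nuQ \<nu> S F < Pinf" if "S \<in> QQ" for S
    using nuQ_finite[of S _ F] QQ_Psi QQ_finite_value that F_monic by fastforce
  then have P: "above Pinf" by (simp add: above_def)
  show ?thesis
  proof (cases "qcoeff Q F l = 0")
    case True
    then show ?thesis using P unfolding eq by (simp add: above_delta_def)
  next
    case False
    have d: "degree (qcoeff Q F l) < m"
      using degree_qcoeff[OF QQ_degree_pos[OF Q]] QQ_degree[OF Q] by simp
    then obtain a where a: "\<nu> (qcoeff Q F l) = Fin a" using small_finite_value False by blast
    have "a + nsm l g \<in> Gam \<nu>"
      using small_value_in_Gam[OF d False a] Psi_value_in_Gam[OF QQ_Psi[OF Q] g] Gam_plus Gam_nsm by blast
    moreover have "\<nu> (qcoeff Q F l * Q ^ l) = Fin (a + nsm l g)"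
      using nu_power[OF g] a by (simp add: nu_mult)
    ultimately show ?thesis
      unfolding eq by (auto simp: above_delta_def deltaL_def above_def not_le)
  qed
qed

lemma Jset_iff: "l \<in> Jset \<nu> m QQ F \<longleftrightarrow> l \<le> D \<and> ev_Q \<nu> QQ (\<lambda>Q. above (\<nu> (qcoeff Q F l * Q ^ l)))"
  unfolding Jset_def mem_Collect_eq using ev_Q_cong[OF above_delta_iff] by simp

abbreviation "J \<equiv> Jset \<nu> m QQ F"
abbreviation "B \<equiv> Bset \<nu> m QQ F"

lemma J_subset: "J \<subseteq> {0..D}"
  by (auto simp: Jset_def)

lemma finite_J: "finite J"
  using J_subset finite_subset by blast

lemma finite_B: "finite B"
  by (simp add: Bset_def)

lemma not_above_cofinal:
  assumes "l \<in> B" "R0 \<in> QQ"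
  shows "\<exists>R\<in>QQ. \<nu> R0 \<le> \<nu> R \<and> \<not> above (\<nu> (qcoeff R F l * R ^ l))"
  using not_ev_Q_cofinal[OF _ ev_Q_ge[OF assms(2)]] assms(1) Jset_iff[of l] by (auto simp: Bset_def)

text \<open>Otherwise removing the top term would leave an unstable polynomial of degree below that
  of \<open>F\<close>.\<close>

lemma top_notin_J: "D \<notin> J"
proof
  assume "D \<in> J"
  then obtain Q where Q: "Q \<in> QQ" "above (\<nu> (qcoeff Q F D * Q ^ D))"
    using Jset_iff ev_Q_ex by blast
  define h where "h = qcoeff Q F D * Q ^ D"
  have dQ: "degree Q = m" "0 < degree Q" using QQ_degree QQ_degree_pos Q(1) by auto
  have "degree (qcoeff Q F D) < m" using degree_qcoeff[OF dQ(2)] dQ(1) by simp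
  then have "nuQ \<nu> Q h = \<nu> h" unfolding h_def by (intro nuQ_small_mult_power_later Q(1)) auto
  then have "\<not> stable \<nu> QQ (F - h)"
    using unstable_diff(2)[OF F_unstable Q(1), of h] Q(2) by (simp add: above_def h_def)
  moreover have "degree (F - h) < degree F"
  proof -
    have "{0..D} = insert D {..<D}" by auto
    then have "F = h + qpart Q F {..<D}"
      using qpart_full[OF dQ(2), of F D] dQ(1) by (simp add: qpart_def h_def)
    then have "F - h = qpart Q F {..<D}" by (metis add_diff_cancel_left')
    then show ?thesis
      using degree_qpart_less[OF dQ(2), of "{..<D}" D "degree F"] D_times_m dQ(1) degree_F_ge m_pos by simp
  qed
  ultimately show False using stable_if_degree_less by blast
qed

lemma J_less: "J \<subseteq> {..<D}"
proof
  fix l assume "l \<in> J"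
  then have "l \<le> D" "l \<noteq> D" using J_subset top_notin_J by auto
  then show "l \<in> {..<D}" by simp
qed

text \<open>Otherwise removing the constant digit would leave \<open>F div Q * Q\<close> unstable,
  although both factors are stable.\<close>

lemma zero_notin_J: "0 \<notin> J"
proof
  assume "0 \<in> J"
  then obtain Q where Q: "Q \<in> QQ" "above (\<nu> (F mod Q))"
    using Jset_iff[of 0] ev_Q_ex[of "\<lambda>Q. above (\<nu> (F mod Q))"] by auto
  have dQ: "degree Q = m" "0 < degree Q" using QQ_degree QQ_degree_pos Q(1) by auto
  have "degree (F mod Q) < m" using degree_qcoeff[OF dQ(2), of F 0] dQ(1) by simp
  then have "nuQ \<nu> Q (F mod Q) = \<nu> (F mod Q)"
    using nuQ_small QQ_Psi QQ_finite_value Q(1) by blast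
  then have "\<not> stable \<nu> QQ (F - F mod Q)"
    using unstable_diff(2)[OF F_unstable Q(1), of "F mod Q"] Q(2) by (simp add: above_def)
  moreover have "F - F mod Q = F div Q * Q" by (simp add: minus_mod_eq_div_mult)
  moreover have "degree (F div Q) < degree F"
    using dQ degree_F_ge m_pos degree_div_eq[of Q F] by fastforce
  ultimately show False
    using stable_mult[OF stable_if_degree_less stable_key[OF Q(1)]] by metis
qed

lemma zero_in_B: "0 \<in> B"
  using zero_notin_J by (simp add: Bset_def)

text \<open>The value of \<open>F mod Q\<close> bounds the truncated values from above, and they
  grow strictly; since \<open>0\<close> is in \<open>B\<close>, an eventual constant
  \<open>c\<close> would be reached by some truncation and then surpassed.\<close>

lemma zero_notin_Bct: "0 \<notin> Bct \<nu> m QQ F"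
proof
  assume "0 \<in> Bct \<nu> m QQ F"
  then obtain c where c: "ev_Q \<nu> QQ (\<lambda>Q. \<nu> (F mod Q) = c)"
    unfolding Bct_def ult_const_def by auto
  obtain Q0 where Q0: "Q0 \<in> QQ" "\<And>Q. Q \<in> QQ \<Longrightarrow> \<nu> Q0 \<le> \<nu> Q \<Longrightarrow> \<nu> (F mod Q) = c"
    using c unfolding ev_Q_def by blast
  obtain R where R: "R \<in> QQ" "\<nu> Q0 \<le> \<nu> R" "\<not> above (\<nu> (F mod R))"
    using not_above_cofinal[OF zero_in_B Q0(1)] by auto
  then have "\<nu> (F mod R) = c" using Q0 by simp
  then obtain S where S: "S \<in> QQ" "c \<le> nuQ \<nu> S F" using R(3) by (auto simp: above_def not_less)
  obtain T where T: "T \<in> QQ" "\<nu> S < \<nu> T" "\<nu> Q0 \<le> \<nu> T"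
    using ev_Q_ex[OF ev_Q_conj[OF ev_Q_gt[OF S(1)] ev_Q_ge[OF Q0(1)]]] by blast
  obtain g where g: "\<nu> T = Fin g" using QQ_finite_value T(1) by blast
  have "c < nuQ \<nu> T F" using S(2) unstable_strict[OF F_unstable S(1) T(1,2)] by (rule le_less_trans)
  also have "\<dots> \<le> \<nu> (F mod T) + Fin 0" using nuQ_le[OF QQ_Psi[OF T(1)] g, of F 0] by simp
  also have "\<dots> = c" using Q0(2)[OF T(1,3)] by (cases c) simp_all
  finally show False by simp
qed

lemma above_diff: "above (\<nu> f) \<Longrightarrow> above (\<nu> h) \<Longrightarrow> above (\<nu> (f - h))"
  unfolding above_def using nu_diff_gt by blast

lemma above_mono: "above x \<Longrightarrow> x \<le> y \<Longrightarrow> above y"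
  unfolding above_def using less_le_trans by blast

lemma above_nuQ_qpart:
  assumes R: "R \<in> QQ" and N: "finite N" and a: "\<And>l. l \<in> N \<Longrightarrow> above (\<nu> (qcoeff R f l * R ^ l))"
  shows "above (nuQ \<nu> R (qpart R f N))"
  unfolding above_def
proof
  fix S assume S: "S \<in> QQ"
  obtain g where g: "\<nu> R = Fin g" using QQ_finite_value R by blast
  obtain t where t: "nuQ \<nu> S F = Fin t"
    using nuQ_finite[OF QQ_Psi[OF S], of _ F] QQ_finite_value[OF S] F_monic by fastforce
  show "nuQ \<nu> S F < nuQ \<nu> R (qpart R f N)"
  proof (rule nuQ_gtI[OF QQ_Psi[OF R] g])
    fix i
    have "nuQ \<nu> S F < \<nu> (qcoeff R f i) + Fin (nsm i g)" if "i \<in> N"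
      using a[OF that] S unfolding above_def nu_qcoeff_term[OF QQ_Psi[OF R] g] by blast
    then show "nuQ \<nu> S F < \<nu> (qcoeff R (qpart R f N) i) + Fin (nsm i g)"
      using t by (simp add: qcoeff_qpart[OF QQ_degree_pos[OF R] N])
  qed
qed

text \<open>Terms indexed by \<open>J\<close> are eventually too large in value to matter, while
  each term indexed by \<open>B\<close> is cofinally often too small to be omitted.\<close>

theorem qpart_B_min_limit:
  "ev_Q \<nu> QQ (\<lambda>Q. min_limit_KP \<nu> m QQ (qpart Q F B))"
proof -
  have "ev_Q \<nu> QQ (\<lambda>Q. \<forall>l\<in>J. above (\<nu> (qcoeff Q F l * Q ^ l)))"
    using finite_J by (rule ev_Q_Ball) (use Jset_iff in blast)
  then obtain Q0 where Q0: "Q0 \<in> QQ"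
    and J: "\<And>Q l. Q \<in> QQ \<Longrightarrow> \<nu> Q0 \<le> \<nu> Q \<Longrightarrow> l \<in> J \<Longrightarrow> above (\<nu> (qcoeff Q F l * Q ^ l))"
    unfolding ev_Q_def by blast
  have "min_limit_KP \<nu> m QQ (qpart Q F B)" if Q: "Q \<in> QQ" "\<nu> Q0 \<le> \<nu> Q" for Q
  proof -
    define H G where "H = qpart Q F J" and "G = qpart Q F B"
    have dQ: "degree Q = m" "0 < degree Q" using QQ_degree QQ_degree_pos Q(1) by auto
    have posF: "0 < degree F" using degree_F_ge m_pos by simp
    have split: "qpart R f {0..D} = qpart R f B + qpart R f J" for R f
    proof -
      have "{0..D} = B \<union> J" "B \<inter> J = {}" using J_subset by (auto simp: Bset_def)
      then show ?thesis unfolding qpart_def using finite_J finite_B by (simp add: sum.union_disjoint)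
    qed
    have G_eq: "G = F - H"
      using split[of Q F] qpart_full[OF dQ(2), of F D] dQ(1)
      unfolding G_def H_def by (metis add_diff_cancel_right' order_refl)
    have aH: "above (nuQ \<nu> Q H)"
      unfolding H_def by (rule above_nuQ_qpart[OF Q(1) finite_J J[OF Q]])
    have deg_J: "degree (qpart R f J) < degree F" if "R \<in> QQ" for R f
      using degree_qpart_less[OF QQ_degree_pos[OF that] J_less _ posF] D_times_m QQ_degree[OF that] by simp
    have G_KP: "G \<in> KPinf \<nu> QQ" and dG: "degree G = degree F"
      unfolding G_eq using KPinf_diff[OF Q(1) aH] deg_J[OF Q(1)] by (simp_all add: H_def)
    have H_later: "above (\<nu> (qcoeff R H l * R ^ l))" if R: "R \<in> QQ" "\<nu> Q \<le> \<nu> R" for R l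
    proof -
      obtain g where g: "\<nu> R = Fin g" using QQ_finite_value R by blast
      have "nuQ \<nu> Q H \<le> nuQ \<nu> R H" by (rule nuQ_mono_QQ[OF Q(1) R])
      also have "\<dots> \<le> \<nu> (qcoeff R H l * R ^ l)"
        using nuQ_le[OF QQ_Psi[OF R(1)] g] nu_qcoeff_term[OF QQ_Psi[OF R(1)] g] by simp
      finally show ?thesis using above_mono aH by blast
    qed
    have term_eq: "qcoeff R G l * R ^ l = qcoeff R F l * R ^ l - qcoeff R H l * R ^ l" for R l
      by (simp add: G_eq qcoeff_diff left_diff_distrib)
    \<comment> \<open>\<open>K R\<close> is everything separating \<open>F\<close> from the
      \<open>B\<close>-part of \<open>G\<close> in base \<open>R\<close>: the part removed at
      \<open>Q\<close> and the new \<open>J\<close>-terms of \<open>G\<close>.\<close>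
    define K where "K R = H + qpart R G J" for R
    have K: "qpart R G B = F - K R" "above (nuQ \<nu> R (K R))" "degree (K R) < degree F"
      if R: "R \<in> QQ" "\<nu> Q \<le> \<nu> R" for R
    proof -
      show "qpart R G B = F - K R"
        using split[of R G] qpart_full[OF QQ_degree_pos[OF R(1)], of G D] QQ_degree[OF R(1)] dG
        by (simp add: K_def G_eq algebra_simps)
      have "above (\<nu> (qcoeff R G l * R ^ l))" if "l \<in> J" for l
        unfolding term_eq using J[OF R(1) order_trans[OF Q(2) R(2)] that] H_later[OF R] by (rule above_diff)
      then have "above (nuQ \<nu> R (qpart R G J))" by (rule above_nuQ_qpart[OF R(1) finite_J])
      moreover have "above (nuQ \<nu> R H)" using aH nuQ_mono_QQ[OF Q(1) R] by (rule above_mono)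
      ultimately show "above (nuQ \<nu> R (K R))"
        unfolding above_def K_def
        using nuQ_add_gt[OF QQ_Psi[OF R(1)]] QQ_finite_value[OF R(1)] by blast
      show "degree (K R) < degree F"
        unfolding K_def H_def by (intro degree_add_less deg_J R Q)
    qed
    have "G = qpart Q G B"
    proof -
      have "qcoeff Q G l = qcoeff Q F l" if "l \<in> B" for l
        using that by (simp add: G_def qcoeff_qpart[OF dQ(2) finite_B])
      then show ?thesis by (simp add: G_def qpart_def)
    qed
    moreover have "qpart R G B \<in> KPinf \<nu> QQ" if "R \<in> QQ" "\<nu> Q \<le> \<nu> R" for R
      using KPinf_diff(1)[OF that(1) K(2,3)[OF that]] K(1)[OF that] by simp
    moreover have "cofinal_in \<nu> {R. qpart R G (B - {l}) \<notin> KPinf \<nu> QQ} QQ" if l: "l \<in> B" for l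
      unfolding cofinal_in_def
    proof
      fix R0 assume "R0 \<in> QQ"
      then obtain R1 where R1: "R1 \<in> QQ" "\<nu> R0 \<le> \<nu> R1" "\<nu> Q \<le> \<nu> R1"
        using ev_Q_ex[OF ev_Q_conj[OF ev_Q_ge ev_Q_ge[OF Q(1)]]] by blast
      obtain R where R: "R \<in> QQ" "\<nu> R1 \<le> \<nu> R" "\<not> above (\<nu> (qcoeff R F l * R ^ l))"
        using not_above_cofinal[OF l R1(1)] by blast
      have QR: "\<nu> Q \<le> \<nu> R" and R0R: "\<nu> R0 \<le> \<nu> R" using R1 R(2) by auto
      \<comment> \<open>The omitted term \<open>u\<close> inherits the small value of the
        corresponding term of \<open>F\<close>. At a later key \<open>T\<close> it dominates
        \<open>F - K R\<close>, so the truncation at \<open>T\<close> is exact on the difference,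
        which is therefore stable.\<close>
      define u where "u = qcoeff R G l * R ^ l"
      obtain S where S: "S \<in> QQ" "\<nu> (qcoeff R F l * R ^ l) \<le> nuQ \<nu> S F"
        using R(3) by (auto simp: above_def not_less)
      have "nuQ \<nu> S F < \<nu> (qcoeff R H l * R ^ l)" using H_later[OF R(1) QR] S(1) by (simp add: above_def)
      then have "\<nu> u = \<nu> (qcoeff R F l * R ^ l)"
        unfolding u_def term_eq using S(2) by (intro nu_diff_eq) simp
      then have uS: "\<nu> u \<le> nuQ \<nu> S F" using S(2) by simp
      obtain T where T: "T \<in> QQ" "\<nu> S < \<nu> T" "\<nu> R \<le> \<nu> T"
        using ev_Q_ex[OF ev_Q_conj[OF ev_Q_gt[OF S(1)] ev_Q_ge[OF R(1)]]] by blast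
      obtain g where g: "\<nu> T = Fin g" using QQ_finite_value T(1) by blast
      have "nuQ \<nu> T (F - K R) = nuQ \<nu> T F"
        using unstable_diff(1)[OF F_unstable R(1) _ T(1,3)] K(2)[OF R(1) QR] by (simp add: above_def)
      then have uT: "\<nu> u < nuQ \<nu> T (F - K R)"
        using uS unstable_strict[OF F_unstable S(1) T(1,2)] by simp
      have "degree (qcoeff R G l) < m"
        using degree_qcoeff[OF QQ_degree_pos[OF R(1)]] QQ_degree[OF R(1)] by simp
      then have "nuQ \<nu> T u = \<nu> u" unfolding u_def by (rule nuQ_small_mult_power_later[OF R(1) T(1,3)])
      then have "nuQ \<nu> T (u - (F - K R)) = \<nu> u"
        using nuQ_diff_eq[OF QQ_Psi[OF T(1)] g, of u "F - K R"] uT by simp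
      moreover have "\<nu> (u - (F - K R)) = \<nu> u"
        using less_le_trans[OF uT nuQ_le_nu_QQ[OF T(1)]] by (rule nu_diff_eq)
      ultimately have "nuQ \<nu> T (u - (F - K R)) = \<nu> (u - (F - K R))" by simp
      then have "nuQ \<nu> T (F - K R - u) = \<nu> (F - K R - u)"
        using nuQ_uminus[OF QQ_Psi[OF T(1)] g, of "u - (F - K R)"] nu_uminus[of "u - (F - K R)"]
        by (simp only: minus_diff_eq)
      then have "stable \<nu> QQ (F - K R - u)" using stable_if_nuQ_eq_nu T(1) by blast
      moreover have "qpart R G (B - {l}) = F - K R - u"
        using K(1)[OF R(1) QR] l finite_B by (simp add: qpart_def u_def sum_diff1)
      ultimately have "qpart R G (B - {l}) \<notin> KPinf \<nu> QQ" by (simp add: KPinf_def)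
      then show "\<exists>R\<in>{R. qpart R G (B - {l}) \<notin> KPinf \<nu> QQ}. R \<in> QQ \<and> \<nu> R0 \<le> \<nu> R"
        using R(1) R0R by blast
    qed
    moreover have "B \<subseteq> {0..degree G div m}" by (auto simp: Bset_def dG)
    ultimately have "min_limit_KP \<nu> m QQ G"
      unfolding min_limit_KP_def using G_KP Q(1) by blast
    then show ?thesis by (simp add: G_def)
  qed
  then show ?thesis unfolding ev_Q_def using Q0 by blast
qed

end

section \<open>Vertically bounded families\<close>

text \<open>A range independent of \<open>l\<close> allows the double sum to be swapped; the added
  binomial coefficients are 0.\<close>

lemma binomial_expansion_bounded:
  fixes a b :: "'a::comm_ring_1"
  assumes "l \<le> k"
  shows "(a + b) ^ l = (\<Sum>i\<le>k. of_nat (l choose i) * (a ^ i * b ^ (l - i)))"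
proof -
  have "(a + b) ^ l = (\<Sum>i\<le>l. of_nat (l choose i) * (a ^ i * b ^ (l - i)))"
    by (simp add: binomial_ring mult.assoc)
  also have "\<dots> = (\<Sum>i\<le>k. of_nat (l choose i) * (a ^ i * b ^ (l - i)))"
    using assms by (intro sum.mono_neutral_left) (simp_all add: binomial_eq_0 not_le)
  finally show ?thesis .
qed

lemma dvd_power_diff: "(a - b) dvd a ^ k - (b::'a::comm_ring_1) ^ k"
proof (induction k)
  case (Suc k)
  have "a ^ Suc k - b ^ Suc k = a * (a ^ k - b ^ k) + (a - b) * b ^ k"
    by (simp add: algebra_simps)
  then show ?case using Suc by (metis dvd_add dvd_mult dvd_triv_left)
qed simp

context limit_key_polynomial
begin

text \<open>Boundedness at \<open>g1\<close> with ratio \<open>(k+1)/k\<close> gives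
  \<open>k (g - g1) < (k+1) (g0 - g1)\<close>, that is, \<open>k (g - g0) < g0 - g1\<close>. Taking
  \<open>k = Suc D\<close> makes \<open>k\<close> positive and the growth of \<open>D\<close> copies
  small as well.\<close>

lemma vert_bounded_gap:
  assumes vb: "vert_bounded \<nu> QQ"
  obtains Q1 Q0 g1 g0 where "Q1 \<in> QQ" "\<nu> Q1 = Fin g1" "Q0 \<in> QQ" "\<nu> Q0 = Fin g0" "g1 < g0"
    "\<And>Q g. Q \<in> QQ \<Longrightarrow> \<nu> Q = Fin g \<Longrightarrow> g0 \<le> g \<Longrightarrow> nsm D (g - g0) < g0 - g1"
proof -
  obtain Q1 where Q1: "Q1 \<in> QQ" using QQ_ne by blast
  obtain g1 where g1: "\<nu> Q1 = Fin g1" using QQ_finite_value Q1 by blast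
  have L: "g \<in> gammaL \<nu> QQ" if "Q \<in> QQ" "\<nu> Q = Fin g" for Q g
    using that Psi_value_in_Gam[OF QQ_Psi] unfolding gammaL_def by (auto intro!: bexI[of _ Q])
  define k where "k = Suc D"
  define q where "q = Fract (int k + 1) (int k)"
  have k: "0 < k" by (simp add: k_def)
  then have "1 < q" by (simp add: q_def One_rat_def)
  then obtain y where y: "y \<in> gammaL \<nu> QQ" "\<And>z. z \<in> gammaL \<nu> QQ \<Longrightarrow> z - g1 < rscale q (y - g1)"
    using vb L[OF Q1 g1] unfolding vert_bounded_def vert_bounded_cut_def by blast
  obtain Q0 where Q0: "Q0 \<in> QQ" "Fin y \<le> \<nu> Q0" using y(1) unfolding gammaL_def by blast
  obtain g0 where g0: "\<nu> Q0 = Fin g0" using QQ_finite_value Q0 by blast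
  have gap: "nsm k (g - g0) < g0 - g1" if "Q \<in> QQ" "\<nu> Q = Fin g" for Q g
  proof -
    have "nsm k (g - g1) < nsm k (rscale q (y - g1))"
      using nsm_strict_mono[OF y(2)[OF L[OF that]] k] .
    also have "\<dots> = nsm (Suc k) (y - g1)"
      unfolding q_def by (rule nsm_rscale_succ_ratio[OF div k])
    also have "\<dots> \<le> nsm (Suc k) (g0 - g1)" using Q0(2) g0 by (intro nsm_mono) simp
    finally have "nsm k g - nsm k g1 < g0 + nsm k g0 - (g1 + nsm k g1)"
      by (simp only: nsm_Suc nsm_diff)
    then have "nsm k g - nsm k g0 < g0 - g1"
      by (simp add: algebra_simps)
    then show ?thesis by (simp add: nsm_diff)
  qed
  have "g1 < g0" using gap[OF Q0(1) g0] by simp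
  moreover have "nsm D (g - g0) < g0 - g1" if "Q \<in> QQ" "\<nu> Q = Fin g" "g0 \<le> g" for Q g
    using le_less_trans[OF nsm_mono_left[of "g - g0" D k] gap[OF that(1,2)]] that(3)
    by (simp add: k_def)
  ultimately show ?thesis using that Q1 g1 Q0(1) g0 by blast
qed

text \<open>Lowering the weight from \<open>g'\<close> to \<open>g\<close> costs at most
  \<open>D\<close> times the difference, since digits beyond \<open>D\<close> vanish. At weight
  \<open>g = \<nu> Q\<close> the key \<open>S\<close> can then be exchanged for
  \<open>Q\<close>.\<close>

lemma nuQ_growth:
  assumes Q: "Q \<in> QQ" "\<nu> Q = Fin g" "nuQ \<nu> Q F = Fin s"
    and S: "S \<in> QQ" "\<nu> S = Fin g'" "nuQ \<nu> S F = Fin t" and le: "g \<le> g'"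
  shows "t \<le> s + nsm D (g' - g)"
proof -
  have w: "wge S g' t F" by (rule wge_nuQ[OF QQ_Psi[OF S(1)] S(2,3)])
  have "wge S g (t - nsm D (g' - g)) F"
    unfolding wge_iff
  proof
    fix i
    show "Fin (t - nsm D (g' - g) - nsm i g) \<le> \<nu> (qcoeff S F i)"
    proof (cases "i \<le> D")
      case True
      have "nsm i (g' - g) \<le> nsm D (g' - g)" using True le by (intro nsm_mono_left) simp_all
      then have "t - nsm D (g' - g) - nsm i g \<le> t - nsm i g'"
        by (simp add: nsm_diff[of i] algebra_simps)
      then show ?thesis
        using w unfolding wge_iff by (auto intro: order_trans[of _ "Fin (t - nsm i g')"])
    next
      case False
      then have "degree F < i * degree S"
        using QQ_degree[OF S(1)] m_pos by (simp add: div_less_iff_less_mult not_le)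
      then show ?thesis by (simp add: qcoeff_beyond)
    qed
  qed
  then have "wge Q g (t - nsm D (g' - g)) F"
    using Q S le by (intro wge_change_key[OF QQ_Psi[OF Q(1)] Q(2) QQ_Psi[OF S(1)] _ QQ_Psi[OF Q(1)]]) simp_all
  then have "Fin (t - nsm D (g' - g)) \<le> nuQ \<nu> Q F"
    using nuQ_ge_iff_wge[OF QQ_Psi[OF Q(1)] Q(2)] by simp
  then show ?thesis using Q(3) by (simp add: algebra_simps)
qed

text \<open>The \<open>i\<close>-th Hasse derivative of the \<open>P\<close>-expansion of
  \<open>F\<close>, taken in the key variable and evaluated at \<open>h\<close>. For
  \<open>l < i\<close> the binomial coefficient is 0, so the truncated exponent is harmless.\<close>

definition taylor :: "'k poly \<Rightarrow> 'k poly \<Rightarrow> nat \<Rightarrow> 'k poly" where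
  "taylor P h i = (\<Sum>l\<le>D. of_nat (l choose i) * (qcoeff P F l * h ^ (l - i)))"

lemma taylor_expansion:
  assumes P: "P \<in> QQ"
  shows "F = (\<Sum>i\<le>D. taylor P (P - Q) i * Q ^ i)"
proof -
  have "F = (\<Sum>l\<le>D. qcoeff P F l * (Q + (P - Q)) ^ l)"
    using qpart_full[OF QQ_degree_pos[OF P], of F D] QQ_degree[OF P]
    by (simp add: qpart_def atLeast0AtMost)
  also have "\<dots> = (\<Sum>l\<le>D. \<Sum>i\<le>D. of_nat (l choose i) * (qcoeff P F l * (P - Q) ^ (l - i)) * Q ^ i)"
    by (intro sum.cong refl, subst binomial_expansion_bounded[of _ D])
      (simp_all add: sum_distrib_left mult_ac)
  also have "\<dots> = (\<Sum>i\<le>D. taylor P (P - Q) i * Q ^ i)"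
    by (subst sum.swap) (simp add: taylor_def sum_distrib_right)
  finally show ?thesis .
qed

text \<open>\<open>P - Q\<close> and \<open>P\<close> agree modulo \<open>Q\<close>, so the residue
  comes from a polynomial independent of \<open>Q\<close>.\<close>

lemma taylor_mod: "taylor P (P - Q) i mod Q = taylor P P i mod Q"
proof -
  have "Q dvd taylor P P i - taylor P (P - Q) i"
    unfolding taylor_def sum_subtractf[symmetric] right_diff_distrib[symmetric]
    using dvd_power_diff[of P "P - Q"] by (intro dvd_sum dvd_mult) simp
  then show ?thesis by (metis mod_eq_dvd_iff)
qed

lemma degree_taylor_less:
  assumes P: "P \<in> QQ" and i: "0 < i"
  shows "degree (taylor P P i) < degree F"
  unfolding taylor_def
proof (rule degree_sum_less)
  fix l assume l: "l \<in> {..D}"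
  show "degree (of_nat (l choose i) * (qcoeff P F l * P ^ (l - i))) < degree F"
  proof (cases "i \<le> l")
    case True
    have "degree (of_nat (l choose i) * (qcoeff P F l * P ^ (l - i)))
        \<le> degree (qcoeff P F l) + degree (P ^ (l - i))"
      using degree_mult_le[of "of_nat (l choose i)" "qcoeff P F l * P ^ (l - i)"]
        degree_mult_le[of "qcoeff P F l" "P ^ (l - i)"] by simp
    also have "\<dots> \<le> degree (qcoeff P F l) + m * (l - i)"
      using degree_power_le[of P "l - i"] QQ_degree[OF P] by simp
    also have "\<dots> < m + m * (l - i)"
      using degree_qcoeff[OF QQ_degree_pos[OF P]] QQ_degree[OF P] by simp
    also have "\<dots> = m * Suc (l - i)" by simp
    also have "\<dots> \<le> m * D" using l i True by (intro mult_le_mono2) auto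
    also have "\<dots> \<le> degree F" by simp
    finally show ?thesis .
  next
    case False
    then show ?thesis using degree_F_ge m_pos by (simp add: binomial_eq_0)
  qed
qed (use degree_F_ge m_pos in simp)

text \<open>The digit at \<open>l\<close> has value at least \<open>t - l g0\<close> and
  \<open>P - Q\<close> has value at least \<open>g0\<close>; both bounds survive multiplication at
  the common weight \<open>g1\<close>.\<close>

lemma wge_taylor:
  assumes Q1: "Q1 \<in> QQ" "\<nu> Q1 = Fin g1" and P: "P \<in> QQ" "\<nu> P = Fin g0" "nuQ \<nu> P F = Fin t"
    and Q: "Q \<in> QQ" "\<nu> P \<le> \<nu> Q" and le: "g1 \<le> g0"
  shows "wge Q g1 (t - nsm i g0) (taylor P (P - Q) i)"
  unfolding taylor_def
proof (rule wge_sum)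
  fix l
  have key: "Q1 \<in> Psi \<nu> m" "Q \<in> Psi \<nu> m" "\<nu> Q1 = Fin g1" "\<nu> Q1 \<le> \<nu> Q"
    using Q1 P Q le QQ_Psi by (auto intro: order_trans[of _ "Fin g0"])
  have dP: "degree P = m" "0 < degree P" "degree Q = m"
    using QQ_degree QQ_degree_pos P(1) Q(1) by auto
  show "wge Q g1 (t - nsm i g0) (of_nat (l choose i) * (qcoeff P F l * (P - Q) ^ (l - i)))"
  proof (cases "i \<le> l")
    case True
    have "Fin t \<le> \<nu> (qcoeff P F l) + Fin (nsm l g0)"
      using nuQ_le[OF QQ_Psi[OF P(1)] P(2)] P(3) by metis
    then have a: "wge Q g1 (t - nsm l g0) (qcoeff P F l)"
      using degree_qcoeff[OF dP(2), of F l] dP by (subst wge_small) (simp_all add: Fin_le_add_Fin)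
    have "Fin g0 \<le> \<nu> (P - Q)" using P(2) Q(2) by (intro nu_diff_ge) simp_all
    then have "wge Q g1 g0 (P - Q)"
      using Psi_degree_diff[OF QQ_Psi[OF P(1)] QQ_Psi[OF Q(1)]] dP by (subst wge_small) simp_all
    then have h: "wge Q g1 (nsm (l - i) g0) ((P - Q) ^ (l - i))" by (rule wge_key_power[OF key])
    have "nsm l g0 = nsm i g0 + nsm (l - i) g0" using True by (simp flip: nsm_add)
    then have "t - nsm l g0 + nsm (l - i) g0 = t - nsm i g0" by (simp add: algebra_simps)
    then show ?thesis
      using wge_of_nat_mult[OF wge_key_mult[OF key a h], of "l choose i"] by (simp only:)
  qed (simp add: binomial_eq_0)
qed

text \<open>The carries from lower Taylor coefficients are measured by the weight \<open>g1\<close> of a fixed smaller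
  key polynomial, so they exceed \<open>\<nu>\<^sub>P(F) + (g0 - g1)\<close>.\<close>

lemma qcoeff_taylor_approx:
  assumes Q1: "Q1 \<in> QQ" "\<nu> Q1 = Fin g1" and P: "P \<in> QQ" "\<nu> P = Fin g0" "nuQ \<nu> P F = Fin t"
    and Q: "Q \<in> QQ" "\<nu> Q = Fin g" "g0 \<le> g" and le: "g1 \<le> g0" and l: "l \<le> D"
  shows "Fin (t + (g0 - g1) - nsm l g) \<le> \<nu> (qcoeff Q F l - taylor P P l mod Q)"
proof -
  define E where "E = taylor P (P - Q)"
  have pos: "0 < degree Q" using QQ_degree_pos[OF Q(1)] .
  have "qcoeff Q F l = (\<Sum>i\<le>D. qcoeff Q (E i * Q ^ i) l)"
    by (subst taylor_expansion[OF P(1), of Q]) (simp add: qcoeff_sum E_def)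
  also have "\<dots> = (\<Sum>i\<le>D. if l < i then 0 else qcoeff Q (E i) (l - i))"
    by (simp add: qcoeff_mult_power[OF pos])
  \<comment> \<open>Higher Taylor terms do not reach digit \<open>l\<close>, term \<open>l\<close>
    contributes its residue, and the lower terms contribute the carries.\<close>
  also have "\<dots> = (\<Sum>i\<le>l. qcoeff Q (E i) (l - i))"
    using l by (intro sum.mono_neutral_cong_right) auto
  also have "\<dots> = (\<Sum>i<l. qcoeff Q (E i) (l - i)) + E l mod Q"
    by (simp flip: lessThan_Suc_atMost)
  finally have eq: "qcoeff Q F l - taylor P P l mod Q = (\<Sum>i<l. qcoeff Q (E i) (l - i))"
    by (simp add: E_def taylor_mod)
  show ?thesis
    unfolding eq
  proof (rule nu_sum_ge)
    fix i assume i: "i \<in> {..<l}"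
    have "Fin (t - nsm i g0 - nsm (l - i) g1) \<le> \<nu> (qcoeff Q (E i) (l - i))"
      using wge_taylor[OF Q1 P Q(1) _ le, of i] Q P unfolding wge_iff E_def by simp
    moreover have "t + (g0 - g1) - nsm l g \<le> t - nsm i g0 - nsm (l - i) g1"
    proof -
      have "g0 - g1 \<le> g - g1" using Q(3) by simp
      \<comment> \<open>This needs \<open>i < l\<close>: at least one power of \<open>Q\<close> is
        counted with weight \<open>g1\<close> instead of \<open>g\<close>.\<close>
      also have "\<dots> \<le> nsm (l - i) (g - g1)" using i le Q(3) by (intro nsm_ge_self) auto
      also have "\<dots> = nsm (l - i) g - nsm (l - i) g1" by (rule nsm_diff)
      finally have 1: "g0 - g1 \<le> nsm (l - i) g - nsm (l - i) g1" .
      have 2: "nsm i g0 \<le> nsm i g" using Q(3) by (rule nsm_mono)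
      have 3: "nsm l g = nsm i g + nsm (l - i) g" using i by (simp flip: nsm_add)
      show ?thesis using add_mono[OF 1 2] by (simp add: 3 algebra_simps)
    qed
    ultimately show "Fin (t + (g0 - g1) - nsm l g) \<le> \<nu> (qcoeff Q (E i) (l - i))"
      by (auto intro: order_trans[of _ "Fin (t - nsm i g0 - nsm (l - i) g1)"])
  qed
qed

text \<open>The digit at \<open>l\<close> is approximated by the residue of one fixed stable
  polynomial \<open>f\<close>, with an error too large in value to change that of the digit.\<close>

lemma B_subset_Bct:
  assumes vb: "vert_bounded \<nu> QQ" and l: "l \<in> B" "l \<noteq> 0"
  shows "l \<in> Bct \<nu> m QQ F"
proof -
  have lD: "l \<le> D" using l(1) by (simp add: Bset_def)
  obtain Q1 P g1 g0 where Q1: "Q1 \<in> QQ" "\<nu> Q1 = Fin g1" and P: "P \<in> QQ" "\<nu> P = Fin g0"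
    and g10: "g1 < g0"
    and gap: "\<And>Q g. Q \<in> QQ \<Longrightarrow> \<nu> Q = Fin g \<Longrightarrow> g0 \<le> g \<Longrightarrow> nsm D (g - g0) < g0 - g1"
    using vert_bounded_gap[OF vb] by metis
  have "F \<noteq> 0" using F_monic by auto
  then obtain t where t: "nuQ \<nu> P F = Fin t" using nuQ_finite[OF QQ_Psi[OF P(1)] P(2)] by blast
  \<comment> \<open>\<open>T\<close> serves twice: it bounds all truncated values of
    \<open>F\<close> from above, and the carries from below.\<close>
  define T where "T = t + (g0 - g1)"
  have T: "nuQ \<nu> S F < Fin T" if S: "S \<in> QQ" for S
  proof -
    obtain g where g: "\<nu> S = Fin g" using QQ_finite_value S by blast
    obtain s where s: "nuQ \<nu> S F = Fin s" using nuQ_finite[OF QQ_Psi[OF S] g \<open>F \<noteq> 0\<close>] by blast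
    show ?thesis
    proof (cases "g0 \<le> g")
      case True
      have "s \<le> t + nsm D (g - g0)" by (rule nuQ_growth[OF P t S g s True])
      also have "\<dots> < T" unfolding T_def using gap[OF S g True] by simp
      finally show ?thesis using s by simp
    next
      case False
      then have "nuQ \<nu> S F \<le> Fin t" using nuQ_mono_QQ[OF S P(1), of F] g P(2) t by simp
      also have "\<dots> < Fin T" using g10 by (simp add: T_def)
      finally show ?thesis .
    qed
  qed
  define f where "f = taylor P P l"
  have approx: "Fin (T - nsm l g) \<le> \<nu> (qcoeff Q F l - f mod Q)"
    if "Q \<in> QQ" "\<nu> Q = Fin g" "g0 \<le> g" for Q g
    unfolding T_def f_def using qcoeff_taylor_approx[OF Q1 P t that less_imp_le[OF g10] lD] .
  have "stable \<nu> QQ f"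
    unfolding f_def using degree_taylor_less[OF P(1)] l(2) by (intro stable_if_degree_less) simp
  from ev_Q_conj[OF stable_nu_mod[OF this] ev_Q_ge[OF P(1)]]
  have ev: "ev_Q \<nu> QQ (\<lambda>Q. \<nu> (f mod Q) = \<nu> f \<and> \<nu> P \<le> \<nu> Q)" .
  \<comment> \<open>Membership of \<open>l\<close> in \<open>B\<close> yields a later key
    \<open>R\<close> whose term lies below \<open>T\<close>, hence below the error, so that its
    digit has the value of \<open>f\<close>. Passing back from \<open>R\<close> to \<open>Q\<close>
    only weakens the bound.\<close>
  have c: "\<nu> f < Fin (T - nsm l g)" if Q: "Q \<in> QQ" "\<nu> Q = Fin g" for Q g
  proof -
    have "\<not> ev_Q \<nu> QQ (\<lambda>Q. above (\<nu> (qcoeff Q F l * Q ^ l)))"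
      using l(1) lD Jset_iff[of l] by (simp add: Bset_def)
    from not_ev_Q_cofinal[OF this ev_Q_conj[OF ev ev_Q_ge[OF Q(1)]]]
    obtain R where R: "R \<in> QQ" "\<not> above (\<nu> (qcoeff R F l * R ^ l))" "\<nu> (f mod R) = \<nu> f"
      "\<nu> P \<le> \<nu> R" "\<nu> Q \<le> \<nu> R" by blast
    obtain r where r: "\<nu> R = Fin r" using QQ_finite_value R(1) by blast
    obtain S where "S \<in> QQ" "\<nu> (qcoeff R F l * R ^ l) \<le> nuQ \<nu> S F"
      using R(2) unfolding above_def not_less by (auto simp: not_less)
    then have "\<nu> (qcoeff R F l) + Fin (nsm l r) < Fin T"
      using T[of S] nu_qcoeff_term[OF QQ_Psi[OF R(1)] r, of F l] by auto
    then have less: "\<nu> (qcoeff R F l) < Fin (T - nsm l r)"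
      by (cases "\<nu> (qcoeff R F l)") (simp_all add: less_diff_eq)
    also have "\<dots> \<le> \<nu> (qcoeff R F l - f mod R)" using approx[OF R(1) r] R(4) P(2) r by simp
    finally have "\<nu> (qcoeff R F l - (qcoeff R F l - f mod R)) = \<nu> (qcoeff R F l)"
      by (rule nu_diff_eq)
    then have "\<nu> f < Fin (T - nsm l r)" using less R(3) by simp
    also have "\<dots> \<le> Fin (T - nsm l g)" using R(5) Q(2) r by (simp add: nsm_mono)
    finally show ?thesis .
  qed
  have "ev_Q \<nu> QQ (\<lambda>Q. \<nu> (qcoeff Q F l) = \<nu> f)"
    using ev
  proof (rule ev_Q_mono)
    fix Q assume Q: "Q \<in> QQ" "\<nu> (f mod Q) = \<nu> f \<and> \<nu> P \<le> \<nu> Q"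
    obtain g where g: "\<nu> Q = Fin g" using QQ_finite_value Q(1) by blast
    have "\<nu> (f mod Q) < \<nu> (qcoeff Q F l - f mod Q)"
      using less_le_trans[OF c[OF Q(1) g] approx[OF Q(1) g]] Q(2) P(2) g by simp
    from nu_add_eq[OF this] show "\<nu> (qcoeff Q F l) = \<nu> f" using Q(2) by simp
  qed
  then show ?thesis using l(1) unfolding Bct_def ult_const_def by blast
qed

end

theorem mainTheorem9:
  fixes \<nu> :: "'k::field poly \<Rightarrow> 'g::linordered_ab_group_add extended"
    and m :: nat and QQ :: "'k poly set" and F :: "'k poly"
  assumes div: "divisible_group TYPE('g)"
    and val: "is_valuation \<nu>"
    and ws: "well_specified \<nu>"
    and m: "1 \<le> m"
    and Psi_ne: "Psi \<nu> m \<noteq> {}"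
    and Psi_nomax: "\<forall>P\<in>Psi \<nu> m. \<exists>P'\<in>Psi \<nu> m. \<nu> P < \<nu> P'"
    and QQ_sub: "QQ \<subseteq> Psi \<nu> m"
    and QQ_inj: "inj_on \<nu> QQ"
    and QQ_wo: "\<forall>S\<subseteq>QQ. S \<noteq> {} \<longrightarrow> (\<exists>Q\<in>S. \<forall>R\<in>S. \<nu> Q \<le> \<nu> R)"
    and QQ_cof: "\<forall>P\<in>Psi \<nu> m. \<exists>Q\<in>QQ. \<nu> P \<le> \<nu> Q"
    and unstable_ex: "\<exists>f. \<not> stable \<nu> QQ f"
    and vb: "vert_bounded \<nu> QQ"
    and F: "F \<in> KPinf \<nu> QQ"
  shows "ev_Q \<nu> QQ (\<lambda>Q. min_limit_KP \<nu> m QQ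
            (qcoeff Q F 0 + (\<Sum>j\<in>Bct \<nu> m QQ F. qcoeff Q F j * Q ^ j)))"
proof -
  interpret limit_key_polynomial \<nu> m QQ F
    by unfold_locales (fact assms)+
  have B: "B = insert 0 (Bct \<nu> m QQ F)"
    using B_subset_Bct[OF vb] zero_in_B by (auto simp: Bct_def)
  have "finite (Bct \<nu> m QQ F)" using finite_B unfolding B by simp
  \<comment> \<open>As \<open>0\<close> is not in \<open>Bct\<close>, the constant digit is not
    counted twice.\<close>
  then have "qcoeff Q F 0 + (\<Sum>j\<in>Bct \<nu> m QQ F. qcoeff Q F j * Q ^ j) = qpart Q F B" for Q
    unfolding qpart_def B using zero_notin_Bct by simp
  then show ?thesis using qpart_B_min_limit by simp
qed

end
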